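(* The joint queue length process $W$ of the modified Jackson network is positive recurrent if $\lambda_2<\mu_2$ and $\lambda_1<\rho_2\mu_1+(1-\rho_2)\mu_1^*$. If either inequality is reversed (that is, if $\lambda_2>\mu_2$ or $\lambda_1>\rho_2\mu_1+(1-\rho_2)\mu_1^*$), then the process is transient.
   Context: Parameters: $\bar\lambda_1,\bar\lambda_2\ge 0$; $\mu_1,\mu_2>0$; $\mu_1^*\ge\mu_1$; $r_{1,2},r_{2,1}\in[0,1]$ with $r_{1,2}r_{2,1}<1$; $r_{1,0}=1-r_{1,2}$, $r_{2,0}=1-r_{2,1}$. Let $(\lambda_1,\lambda_2)$ be the unique solution of $\lambda_1=\bar\lambda_1+\lambda_2r_{2,1}$, $\lambda_2=\bar\lambda_2+\lambda_1r_{1,2}$; assume $\lambda_1,\lambda_2>0$. Put $\rho_i=\lambda_i/\mu_i$, $i=1,2$. The modified Jackson network is the continuous-time Markov chain $W$ on $S=\{0,1,2,\dots\}^2$ (queue lengths at nodes 1 and 2) with jump rates from $(x,y)$: to $(x+1,y)$ at rate $\bar\lambda_1$; to $(x,y+1)$ at rate $\bar\lambda_2$; if $x>0,y>0$: to $(x-1,y)$ at rate $\mu_1r_{1,0}$ and to $(x-1,y+1)$ at rate $\mu_1r_{1,2}$; if $x>0,y=0$: to $(x-1,0)$ at rate $\mu_1^*r_{1,0}$ and to $(x-1,1)$ at rate $\mu_1^*r_{1,2}$; if $y>0$: to $(x,y-1)$ at rate $\mu_2r_{2,0}$ and to $(x+1,y-1)$ at rate $\mu_2r_{2,1}$. *)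

theory Defs
  imports "HOL-Probability.Probability"
begin

section \<open>Continuous-time Markov chains given by jump rates\<close>

text \<open>
  A function \<open>q\<close> gives the jump rate \<open>q i j\<close> from \<open>i\<close> to \<open>j \<noteq> i\<close>; the values \<open>q i i\<close> are
  irrelevant. The definitions are for chains without absorbing states: every exit rate is
  positive and finite.
\<close>

definition exit_rate :: "('s \<Rightarrow> 's \<Rightarrow> real) \<Rightarrow> 's \<Rightarrow> real" where
  "exit_rate q i = (\<Sum>\<^sub>\<infinity>j\<in>UNIV - {i}. q i j)"

definition jump_prob :: "('s \<Rightarrow> 's \<Rightarrow> real) \<Rightarrow> 's \<Rightarrow> 's \<Rightarrow> real" where
  "jump_prob q i j = (if i = j then 0 else q i j / exit_rate q i)"

text \<open>
  \<open>X\<close> is a continuous-time Markov chain on the probability space \<open>M\<close> with jump rates \<open>q\<close> and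
  initial state \<open>i\<close>, in terms of its jump chain \<open>Y\<close> and holding times \<open>H\<close>: \<open>Y\<close> is a
  discrete-time Markov chain started at \<open>i\<close> with transition probabilities \<open>jump_prob q\<close>, and
  conditionally on \<open>Y\<close> the holding times \<open>H k\<close> are independent and exponentially distributed
  with parameters \<open>exit_rate q (Y k)\<close>. The displayed probabilities of cylinder events
  determine the joint law of \<open>(Y, H)\<close>. Nothing is prescribed after an explosion; for
  bounded exit rates there is almost surely none.
\<close>

definition ctmc_from ::
  "'w measure \<Rightarrow> ('s \<Rightarrow> 's \<Rightarrow> real) \<Rightarrow> 's \<Rightarrow> (real \<Rightarrow> 'w \<Rightarrow> 's) \<Rightarrow> bool" where
  "ctmc_from M q i X \<longleftrightarrow>
     prob_space M \<and>
     (\<forall>t\<ge>0. X t \<in> M \<rightarrow>\<^sub>M count_space UNIV) \<and>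
     (\<exists>(Y :: nat \<Rightarrow> 'w \<Rightarrow> 's) (H :: nat \<Rightarrow> 'w \<Rightarrow> real).
        (\<forall>n. Y n \<in> M \<rightarrow>\<^sub>M count_space UNIV) \<and>
        (\<forall>n. H n \<in> borel_measurable M) \<and>
        (\<forall>n (z :: nat \<Rightarrow> 's) (t :: nat \<Rightarrow> real). (\<forall>k<n. 0 \<le> t k) \<longrightarrow>
           measure M {\<omega> \<in> space M. (\<forall>k\<le>n. Y k \<omega> = z k) \<and> (\<forall>k<n. t k < H k \<omega>)} =
           (if z 0 = i then 1 else 0) *
           (\<Prod>k<n. jump_prob q (z k) (z (Suc k)) * exp (- exit_rate q (z k) * t k))) \<and>
        (AE \<omega> in M. \<forall>n t. (\<Sum>k<n. H k \<omega>) \<le> t \<and> t < (\<Sum>k<Suc n. H k \<omega>) \<longrightarrow> X t \<omega> = Y n \<omega>))"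

text \<open>
  For a path starting in \<open>i\<close>, this is the first time at which the path is back in \<open>i\<close> after
  having left it (\<open>\<infinity>\<close> if there is no such time).
\<close>

definition return_time :: "(real \<Rightarrow> 'w \<Rightarrow> 's) \<Rightarrow> 's \<Rightarrow> 'w \<Rightarrow> ennreal" where
  "return_time X i \<omega> = Inf {ennreal t | t. X t \<omega> = i \<and> (\<exists>s. 0 \<le> s \<and> s < t \<and> X s \<omega> \<noteq> i)}"

text \<open>
  In the following two definitions \<open>P i\<close> is the law under which the chain \<open>X\<close> starts in \<open>i\<close>.
  Recurrence to \<open>i\<close> means that \<open>{t. X t = i}\<close> is unbounded with probability 1, transience that
  it is unbounded with probability 0.
\<close>

definition positive_recurrent :: "('s \<Rightarrow> 'w measure) \<Rightarrow> (real \<Rightarrow> 'w \<Rightarrow> 's) \<Rightarrow> bool" where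
  "positive_recurrent P X \<longleftrightarrow> (\<forall>i. (\<integral>\<^sup>+ \<omega>. return_time X i \<omega> \<partial>P i) < \<infinity>)"

definition transient :: "('s \<Rightarrow> 'w measure) \<Rightarrow> (real \<Rightarrow> 'w \<Rightarrow> 's) \<Rightarrow> bool" where
  "transient P X \<longleftrightarrow> (\<forall>i. AE \<omega> in P i. bdd_above {t. 0 \<le> t \<and> X t \<omega> = i})"


section \<open>The modified Jackson network\<close>

text \<open>
  \<open>a1\<close>, \<open>a2\<close> are the exogenous arrival rates, \<open>m1\<close>, \<open>m2\<close> the service rates, \<open>m1s\<close> is the service
  rate of node 1 while node 2 is empty, and \<open>r12\<close>, \<open>r21\<close> are the routing probabilities. The
  possible targets \<open>z\<close> are pairwise distinct, so at most one summand is nonzero.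
\<close>

definition modified_jackson_rate ::
  "real \<Rightarrow> real \<Rightarrow> real \<Rightarrow> real \<Rightarrow> real \<Rightarrow> real \<Rightarrow> real \<Rightarrow> nat \<times> nat \<Rightarrow> nat \<times> nat \<Rightarrow> real" where
  "modified_jackson_rate a1 a2 m1 m1s m2 r12 r21 = (\<lambda>(x, y) z.
     (if z = (x + 1, y) then a1 else 0) +
     (if z = (x, y + 1) then a2 else 0) +
     (if x > 0 \<and> y > 0 \<and> z = (x - 1, y) then m1 * (1 - r12) else 0) +
     (if x > 0 \<and> y > 0 \<and> z = (x - 1, y + 1) then m1 * r12 else 0) +
     (if x > 0 \<and> y = 0 \<and> z = (x - 1, 0) then m1s * (1 - r12) else 0) +
     (if x > 0 \<and> y = 0 \<and> z = (x - 1, 1) then m1s * r12 else 0) +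
     (if y > 0 \<and> z = (x, y - 1) then m2 * (1 - r21) else 0) +
     (if y > 0 \<and> z = (x + 1, y - 1) then m2 * r21 else 0))"

end

theory Submission
  imports Defs
begin

text \<open>
  The node-2 routing leaves \<open>x + r21 * y\<close> unchanged and the node-1 routing leaves
  \<open>r12 * x + y\<close> unchanged, so their drifts only involve the service rates in use. The second
  function has drift proportional to \<open>l2 - m2\<close> for \<open>y > 0\<close>. Adding \<open>(m1s - m1) / m2\<close> times it to
  the first one gives a function whose drift for \<open>x > 0\<close> is proportional to
  \<open>l1 - (rho2 * m1 + (1 - rho2) * m1s)\<close>, whether or not \<open>y = 0\<close>. If one of the two constants is
  positive, the corresponding function \<open>f\<close> has positive drift everywhere and bounded jumps, so
  \<open>exp (- \<theta> * f)\<close> contracts geometrically along the jump chain and every state is visited finitely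
  often. If both are negative, a quadratic form built from the two functions is a Foster-Lyapunov
  function.
\<close>

section \<open>Discrete random variables\<close>

text \<open>The obstacle is the boundary \<open>y = 0\<close>: there the service rate of node 1
  rises by \<open>m1s - m1\<close> while that of node 2 drops by \<open>m2\<close>. The weight
  \<open>(m1s - m1) / m2\<close> balances the two. The balance fails only at \<open>x = 0\<close>,
  where the idle node 1 makes the drift larger. This is harmless for transience. For recurrence a
  quadratic form is used because its drift multiplies the first linear drift by \<open>x\<close> and
  the second one by \<open>y\<close>, so that each counts only where it is negative. The mixed
  coefficients of the form have to agree, which multiplies the two drifts by coefficients that can
  be 0 for the unperturbed functions; this is the reason for perturbing them. On the probabilistic
  side, the law of \<open>(Y, H)\<close> is known only through cylinder events with lower bounds on
  the holding times. Positivity of the holding times, the Markov property and non-explosion are all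
  derived from these by summing over the countably many finite paths.\<close>

lemma (in prob_space) emeasure_partition_countable:
  fixes Z :: "'a \<Rightarrow> 'b::countable"
  assumes [measurable]: "Z \<in> M \<rightarrow>\<^sub>M count_space UNIV" and A[measurable]: "A \<in> sets M"
  shows "emeasure M A = (\<integral>\<^sup>+ l. emeasure M {\<omega>\<in>A. Z \<omega> = l} \<partial>count_space UNIV)"
proof -
  have "A = (\<Union>l. {\<omega>\<in>A. Z \<omega> = l})" by auto
  then have "emeasure M A = emeasure M (\<Union>l. {\<omega>\<in>A. Z \<omega> = l})" by simp
  also have "\<dots> = (\<integral>\<^sup>+ l. emeasure M {\<omega>\<in>A. Z \<omega> = l} \<partial>count_space UNIV)"
  proof (rule emeasure_UN_countable)
    show "{\<omega> \<in> A. Z \<omega> = l} \<in> sets M" for l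
    proof -
      have "{\<omega> \<in> A. Z \<omega> = l} = {\<omega> \<in> space M. \<omega> \<in> A \<and> Z \<omega> = l}"
        using sets.sets_into_space[OF A] by auto
      then show ?thesis by simp
    qed
  qed (auto simp: disjoint_family_on_def)
  finally show ?thesis .
qed

lemma (in prob_space) nn_integral_discrete_rv:
  fixes Z :: "'a \<Rightarrow> 'b::countable" and F :: "'b \<Rightarrow> ennreal"
  assumes Z[measurable]: "Z \<in> M \<rightarrow>\<^sub>M count_space UNIV"
  shows "(\<integral>\<^sup>+ \<omega>. F (Z \<omega>) \<partial>M) = (\<integral>\<^sup>+ l. F l * emeasure M {\<omega>\<in>space M. Z \<omega> = l} \<partial>count_space UNIV)"
proof -
  have "(\<integral>\<^sup>+ \<omega>. F (Z \<omega>) \<partial>M)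
      = (\<integral>\<^sup>+ \<omega>. (\<integral>\<^sup>+ l. F l * indicator {\<omega>\<in>space M. Z \<omega> = l} \<omega> \<partial>count_space UNIV) \<partial>M)"
  proof (rule nn_integral_cong)
    fix \<omega> assume "\<omega> \<in> space M"
    then have "(\<integral>\<^sup>+ l. F l * indicator {\<omega>\<in>space M. Z \<omega> = l} \<omega> \<partial>count_space UNIV)
      = (\<integral>\<^sup>+ l. F l * indicator {Z \<omega>} l \<partial>count_space UNIV)"
      by (intro nn_integral_cong) (auto simp: indicator_def)
    also have "\<dots> = F (Z \<omega>)" by (subst nn_integral_indicator_singleton) auto
    finally show "F (Z \<omega>) = (\<integral>\<^sup>+ l. F l * indicator {\<omega>\<in>space M. Z \<omega> = l} \<omega> \<partial>count_space UNIV)" ..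
  qed
  also have "\<dots> = (\<integral>\<^sup>+ l. (\<integral>\<^sup>+ \<omega>. F l * indicator {\<omega>\<in>space M. Z \<omega> = l} \<omega> \<partial>M) \<partial>count_space UNIV)"
    by (rule nn_integral_count_space_nn_integral) auto
  also have "\<dots> = (\<integral>\<^sup>+ l. F l * emeasure M {\<omega>\<in>space M. Z \<omega> = l} \<partial>count_space UNIV)"
    by (simp add: nn_integral_cmult_indicator)
  finally show ?thesis .
qed

text \<open>Estimates come from the cylinder formula one path at a time; this sums them over the
  values of \<open>Z\<close> that satisfy \<open>Q\<close>. It is applied with
  \<open>Z = path n\<close>.\<close>

lemma (in prob_space) prob_dominated_discrete_rv:
  fixes Z :: "'a \<Rightarrow> 'b::countable"
  assumes Z[measurable]: "Z \<in> M \<rightarrow>\<^sub>M count_space UNIV" and A: "A \<in> sets M" and "0 \<le> c"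
    and le: "\<And>l. prob {\<omega>\<in>A. Z \<omega> = l} \<le> c * prob {\<omega>\<in>space M. Z \<omega> = l}"
  shows "prob {\<omega>\<in>A. Q (Z \<omega>)} \<le> c * prob {\<omega>\<in>space M. Q (Z \<omega>)}"
proof -
  have [measurable]: "Measurable.pred M (\<lambda>\<omega>. Q (Z \<omega>))" by simp
  have e: "{\<omega>\<in>A. R \<omega>} = {\<omega>\<in>space M. \<omega> \<in> A \<and> R \<omega>}" for R
    using sets.sets_into_space[OF A] by auto
  note A[measurable]
  have "emeasure M {\<omega>\<in>A. Q (Z \<omega>)} = (\<integral>\<^sup>+ l. emeasure M {\<omega>\<in>{\<omega>\<in>A. Q (Z \<omega>)}. Z \<omega> = l} \<partial>count_space UNIV)"
    by (rule emeasure_partition_countable) (auto simp: e)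
  also have "\<dots> \<le> (\<integral>\<^sup>+ l. ennreal c * emeasure M {\<omega>\<in>{\<omega>\<in>space M. Q (Z \<omega>)}. Z \<omega> = l} \<partial>count_space UNIV)"
  proof (rule nn_integral_mono)
    fix l
    have *: "{\<omega>\<in>{\<omega>\<in>B. Q (Z \<omega>)}. Z \<omega> = l} = (if Q l then {\<omega>\<in>B. Z \<omega> = l} else {})" for B
      by auto
    show "emeasure M {\<omega>\<in>{\<omega>\<in>A. Q (Z \<omega>)}. Z \<omega> = l} \<le> ennreal c * emeasure M {\<omega>\<in>{\<omega>\<in>space M. Q (Z \<omega>)}. Z \<omega> = l}"
      unfolding * using le[of l] \<open>0 \<le> c\<close>
      by (auto simp: emeasure_eq_measure ennreal_mult[symmetric] intro!: ennreal_leI)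
  qed
  also have "\<dots> = ennreal c * (\<integral>\<^sup>+ l. emeasure M {\<omega>\<in>{\<omega>\<in>space M. Q (Z \<omega>)}. Z \<omega> = l} \<partial>count_space UNIV)"
    by (rule nn_integral_cmult) auto
  also have "(\<integral>\<^sup>+ l. emeasure M {\<omega>\<in>{\<omega>\<in>space M. Q (Z \<omega>)}. Z \<omega> = l} \<partial>count_space UNIV)
      = emeasure M {\<omega>\<in>space M. Q (Z \<omega>)}"
    by (rule emeasure_partition_countable[symmetric]) auto
  finally show ?thesis
    using \<open>0 \<le> c\<close> by (simp add: emeasure_eq_measure ennreal_mult[symmetric])
qed

section \<open>Jump rates of finite range\<close>

text \<open>For negative \<open>x\<close>, multiply by \<open>1 - x > 0\<close>: the left side
  becomes at most \<open>exp x * exp (- x) = 1\<close>, the right side becomes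
  \<open>1 - x ^ 3\<close>, which is at least 1. The error is of second order, so a linear drift
  outweighs it for small exponents.\<close>

lemma exp_le_quadratic:
  fixes x :: real
  assumes "\<bar>x\<bar> \<le> 1"
  shows "exp x \<le> 1 + x + x\<^sup>2"
proof (cases "0 \<le> x")
  case True
  then show ?thesis using assms by (intro exp_bound) auto
next
  case False
  have "exp x * (1 - x) \<le> exp x * exp (- x)"
    using exp_ge_add_one_self[of "- x"] by (intro mult_left_mono) auto
  also have "\<dots> = 1" by (simp add: exp_minus_inverse)
  also have "\<dots> \<le> 1 - x ^ 3" using False by (simp add: power3_eq_cube mult_nonpos_nonpos mult_nonneg_nonpos)
  also have "\<dots> = (1 + x + x\<^sup>2) * (1 - x)"
    by (simp add: algebra_simps power2_eq_square power3_eq_cube)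
  finally show ?thesis using False by (simp add: mult_le_cancel_right)
qed

text \<open>\<open>N z\<close> is any finite set containing the targets of positive rate; it may
  contain \<open>z\<close>, as happens for the network on the boundary. The bound \<open>hi\<close>
  excludes explosion, \<open>lo\<close> bounds the mean holding times.\<close>

locale finite_range_rates =
  fixes q :: "'s::countable \<Rightarrow> 's \<Rightarrow> real" and N :: "'s \<Rightarrow> 's set" and lo hi :: real
  assumes finite_N: "finite (N z)"
    and q_nonneg: "0 \<le> q z j"
    and q_outside: "j \<notin> N z \<Longrightarrow> q z j = 0"
    and q_diag: "q z z = 0"
    and lo_pos: "0 < lo"
    and lo_le: "lo \<le> (\<Sum>j\<in>N z. q z j)"
    and le_hi: "(\<Sum>j\<in>N z. q z j) \<le> hi"
begin

lemma exit_rate_eq: "exit_rate q z = (\<Sum>j\<in>N z. q z j)"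
proof -
  have "exit_rate q z = infsum (q z) (N z)"
    unfolding exit_rate_def by (rule infsum_cong_neutral) (auto simp: q_outside q_diag)
  then show ?thesis by (simp add: finite_N)
qed

lemma exit_rate_bounds: "lo \<le> exit_rate q z" "exit_rate q z \<le> hi" "0 < exit_rate q z" "0 < hi"
  using lo_le[of z] le_hi[of z] lo_pos by (auto simp: exit_rate_eq)

lemma jump_prob_eq: "jump_prob q z j = q z j / exit_rate q z"
  by (simp add: jump_prob_def q_diag)

lemma jump_prob_nonneg: "0 \<le> jump_prob q z j"
  using exit_rate_bounds(3)[of z] q_nonneg[of z j] by (simp add: jump_prob_eq)

lemma sum_jump_prob: "(\<Sum>j\<in>N z. jump_prob q z j) = 1"
  using exit_rate_bounds(3)[of z]
  by (simp add: jump_prob_eq exit_rate_eq flip: sum_divide_distrib)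

definition step :: "('s \<Rightarrow> real) \<Rightarrow> 's \<Rightarrow> real" where
  "step u z = (\<Sum>j\<in>N z. jump_prob q z j * u j)"

lemma step_mono: "(\<And>j. u j \<le> v j) \<Longrightarrow> step u z \<le> step v z"
  unfolding step_def by (intro sum_mono mult_left_mono jump_prob_nonneg)

lemma step_nonneg: "(\<And>j. 0 \<le> u j) \<Longrightarrow> 0 \<le> step u z"
  unfolding step_def by (intro sum_nonneg mult_nonneg_nonneg jump_prob_nonneg)

lemma step_add: "step (\<lambda>j. u j + v j) z = step u z + step v z"
  by (simp add: step_def distrib_left sum.distrib)

lemma step_cmult: "step (\<lambda>j. c * u j) z = c * step u z"
  by (simp add: step_def sum_distrib_left mult.left_commute)

lemma step_const: "step (\<lambda>j. c) z = c"
  by (simp add: step_def sum_jump_prob flip: sum_distrib_right)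

lemma step_sum: "step (\<lambda>j. \<Sum>n\<in>B. u n j) z = (\<Sum>n\<in>B. step (u n) z)"
  unfolding step_def sum_distrib_left by (rule sum.swap)

lemma nn_integral_jump_prob:
  assumes "\<And>j. 0 \<le> u j"
  shows "(\<integral>\<^sup>+ j. ennreal (jump_prob q z j) * ennreal (u j) \<partial>count_space UNIV) = ennreal (step u z)"
proof -
  have "(\<integral>\<^sup>+ j. ennreal (jump_prob q z j) * ennreal (u j) \<partial>count_space UNIV)
     = (\<Sum>j\<in>N z. ennreal (jump_prob q z j) * ennreal (u j))"
    by (rule nn_integral_count_space') (auto simp: finite_N jump_prob_eq q_outside)
  then show ?thesis
    by (simp add: step_def ennreal_mult[symmetric] assms jump_prob_nonneg sum_ennreal)
qed

definition generator :: "('s \<Rightarrow> real) \<Rightarrow> 's \<Rightarrow> real" where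
  "generator u z = (\<Sum>j\<in>N z. q z j * (u j - u z))"

text \<open>Drifts are computed from the rates, while the estimates run along the jump chain. A jump
  takes \<open>1 / exit_rate q z\<close> on average, hence the factor.\<close>

lemma step_eq_generator: "step u z = u z + generator u z / exit_rate q z"
proof -
  have "step u z * exit_rate q z = (\<Sum>j\<in>N z. q z j * u j)"
    using exit_rate_bounds(3)[of z]
    by (simp add: step_def sum_distrib_right jump_prob_eq)
  moreover have "generator u z = (\<Sum>j\<in>N z. q z j * u j) - exit_rate q z * u z"
    by (simp add: generator_def right_diff_distrib sum_subtractf exit_rate_eq sum_distrib_right)
  ultimately show ?thesis
    using exit_rate_bounds(3)[of z] by (simp add: field_simps)
qed

end

section \<open>Jump chain and holding times\<close>

locale jump_chain = finite_range_rates q N lo hi + prob_space M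
  for q :: "'s::countable \<Rightarrow> 's \<Rightarrow> real" and N lo hi and M :: "'w measure" +
  fixes i :: 's and Y :: "nat \<Rightarrow> 'w \<Rightarrow> 's" and H :: "nat \<Rightarrow> 'w \<Rightarrow> real"
  assumes Y_measurable[measurable]: "\<And>n. Y n \<in> M \<rightarrow>\<^sub>M count_space UNIV"
    and H_measurable[measurable]: "\<And>n. H n \<in> borel_measurable M"
    and cylinder: "\<And>n z t. (\<And>k. k < n \<Longrightarrow> 0 \<le> t k) \<Longrightarrow>
           prob {\<omega> \<in> space M. (\<forall>k\<le>n. Y k \<omega> = z k) \<and> (\<forall>k<n. t k < H k \<omega>)} =
           (if z 0 = i then 1 else 0) *
           (\<Prod>k<n. jump_prob q (z k) (z (Suc k)) * exp (- exit_rate q (z k) * t k))"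
begin

section \<open>Histories and the Markov property of the jump chain\<close>

text \<open>Lists over a countable type are countable, so the whole history is a single discrete
  random variable whose point probabilities come from the cylinder formula.\<close>

definition path :: "nat \<Rightarrow> 'w \<Rightarrow> 's list" where
  "path n \<omega> = map (\<lambda>k. Y k \<omega>) [0..<Suc n]"

lemma path_eq_iff: "path n \<omega> = l \<longleftrightarrow> length l = Suc n \<and> (\<forall>k\<le>n. Y k \<omega> = l ! k)"
  unfolding path_def by (subst list_eq_iff_nth_eq) (auto simp: less_Suc_eq_le simp del: upt_Suc)

lemma path_measurable[measurable]: "path n \<in> M \<rightarrow>\<^sub>M count_space UNIV"
proof (subst measurable_count_space_eq_countable, safe)
  fix l
  have "path n -` {l} \<inter> space M = {\<omega>\<in>space M. path n \<omega> = l}"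
    by auto
  also have "\<dots> = {\<omega>\<in>space M. length l = Suc n \<and> (\<forall>k\<le>n. Y k \<omega> = l ! k)}"
    by (simp only: path_eq_iff)
  also have "\<dots> \<in> sets M" by measurable
  finally show "path n -` {l} \<inter> space M \<in> sets M" .
qed auto

lemma last_path: "last (path n \<omega>) = Y n \<omega>"
  by (simp add: path_def)

lemma nth_path: "k \<le> n \<Longrightarrow> path n \<omega> ! k = Y k \<omega>"
  by (auto simp: path_def less_Suc_eq_le simp del: upt_Suc)

text \<open>Taking all bounds 0 does not yet give the law of \<open>Y\<close>: the strict
  inequalities \<open>0 < H k\<close> stay in the event until they are known to hold almost
  surely.\<close>

lemma cylinder_zero:
  "prob {\<omega> \<in> space M. (\<forall>k\<le>n. Y k \<omega> = z k) \<and> (\<forall>k<n. 0 < H k \<omega>)} =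
     (if z 0 = i then 1 else 0) * (\<Prod>k<n. jump_prob q (z k) (z (Suc k)))"
  using cylinder[of n "\<lambda>_. 0" z] by simp

text \<open>Summing the cylinder formula of length \<open>n + 1\<close> over its last state.\<close>

lemma cylinder_last:
  assumes "0 \<le> t"
  shows "prob {\<omega> \<in> space M. (\<forall>k\<le>n. Y k \<omega> = z k) \<and> (\<forall>k<n. 0 < H k \<omega>) \<and> t < H n \<omega>} =
    prob {\<omega> \<in> space M. (\<forall>k\<le>n. Y k \<omega> = z k) \<and> (\<forall>k<n. 0 < H k \<omega>)} * exp (- exit_rate q (z n) * t)"
    (is "prob ?A = prob ?B * ?e")
proof -
  have [simp]: "?A \<in> sets M" by measurable
  have "emeasure M ?A = (\<integral>\<^sup>+ j. emeasure M {\<omega>\<in>?A. Y (Suc n) \<omega> = j} \<partial>count_space UNIV)"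
    by (rule emeasure_partition_countable) auto
  also have "\<dots> = (\<integral>\<^sup>+ j. ennreal (prob ?B * ?e) * (ennreal (jump_prob q (z n) j) * ennreal 1) \<partial>count_space UNIV)"
  proof (rule nn_integral_cong)
    fix j
    let ?z = "z(Suc n := j)" and ?t = "(\<lambda>_. 0)(n := t)"
    have "{\<omega>\<in>?A. Y (Suc n) \<omega> = j} =
       {\<omega> \<in> space M. (\<forall>k\<le>Suc n. Y k \<omega> = ?z k) \<and> (\<forall>k<Suc n. ?t k < H k \<omega>)}"
      by (auto simp: le_Suc_eq less_Suc_eq)
    then have "prob {\<omega>\<in>?A. Y (Suc n) \<omega> = j} = (if ?z 0 = i then 1 else 0) *
           (\<Prod>k<Suc n. jump_prob q (?z k) (?z (Suc k)) * exp (- exit_rate q (?z k) * ?t k))"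
      using cylinder[of "Suc n" ?t ?z] assms by (auto simp: less_Suc_eq)
    also have "\<dots> = (if z 0 = i then 1 else 0) * (\<Prod>k<n. jump_prob q (z k) (z (Suc k))) *
        (jump_prob q (z n) j * ?e)"
      by (auto intro!: prod.cong)
    also have "\<dots> = prob ?B * ?e * jump_prob q (z n) j"
      by (simp add: cylinder_zero)
    finally show "emeasure M {\<omega>\<in>?A. Y (Suc n) \<omega> = j}
        = ennreal (prob ?B * ?e) * (ennreal (jump_prob q (z n) j) * ennreal 1)"
      by (simp add: emeasure_eq_measure ennreal_mult[symmetric] jump_prob_nonneg)
  qed
  also have "\<dots> = ennreal (prob ?B * ?e) * (\<integral>\<^sup>+ j. ennreal (jump_prob q (z n) j) * ennreal 1 \<partial>count_space UNIV)"
    by (rule nn_integral_cmult) auto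
  also have "\<dots> = ennreal (prob ?B * ?e)"
    by (subst nn_integral_jump_prob) (auto simp: step_const)
  finally show ?thesis by (simp add: emeasure_eq_measure)
qed

text \<open>On each path, adding the condition \<open>0 < H n\<close> costs the factor
  \<open>exp 0 = 1\<close>; summed over all paths, the probability stays 1.\<close>

lemma prob_H_pos: "prob {\<omega> \<in> space M. \<forall>k<n. 0 < H k \<omega>} = 1"
proof (induction n)
  case 0
  then show ?case by (simp add: prob_space)
next
  case (Suc n)
  have eq: "emeasure M {\<omega>\<in>{\<omega> \<in> space M. \<forall>k<Suc n. 0 < H k \<omega>}. path n \<omega> = l} =
     emeasure M {\<omega>\<in>{\<omega> \<in> space M. \<forall>k<n. 0 < H k \<omega>}. path n \<omega> = l}" for l
  proof (cases "length l = Suc n")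
    case True
    then have "{\<omega>\<in>{\<omega> \<in> space M. \<forall>k<Suc n. 0 < H k \<omega>}. path n \<omega> = l} =
       {\<omega> \<in> space M. (\<forall>k\<le>n. Y k \<omega> = l ! k) \<and> (\<forall>k<n. 0 < H k \<omega>) \<and> 0 < H n \<omega>}"
      "{\<omega>\<in>{\<omega> \<in> space M. \<forall>k<n. 0 < H k \<omega>}. path n \<omega> = l} =
       {\<omega> \<in> space M. (\<forall>k\<le>n. Y k \<omega> = l ! k) \<and> (\<forall>k<n. 0 < H k \<omega>)}"
      by (auto simp: path_eq_iff less_Suc_eq)
    then show ?thesis using cylinder_last[of 0 n "(!) l"] by (simp add: emeasure_eq_measure)
  qed (simp add: path_eq_iff)
  have "emeasure M {\<omega> \<in> space M. \<forall>k<Suc n. 0 < H k \<omega>} =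
      emeasure M {\<omega> \<in> space M. \<forall>k<n. 0 < H k \<omega>}"
    by (subst (1 2) emeasure_partition_countable[where Z = "path n"]) (simp_all only: eq, measurable)
  then show ?case using Suc by (simp add: emeasure_eq_measure)
qed

lemma AE_H_pos: "AE \<omega> in M. \<forall>k. 0 < H k \<omega>"
proof -
  have "AE \<omega> in M. 0 < H k \<omega>" for k
  proof -
    have "AE \<omega> in M. \<forall>j<Suc k. 0 < H j \<omega>"
      using prob_H_pos[of "Suc k"] by (subst (asm) prob_eq_1) (auto elim: AE_mp)
    then show ?thesis by eventually_elim auto
  qed
  then show ?thesis by (simp add: AE_all_countable)
qed

lemma prob_path:
  "prob {\<omega> \<in> space M. \<forall>k\<le>n. Y k \<omega> = z k} =
     (if z 0 = i then 1 else 0) * (\<Prod>k<n. jump_prob q (z k) (z (Suc k)))"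
  unfolding cylinder_zero[symmetric]
  by (rule measure_eq_AE) (use AE_H_pos in \<open>auto elim!: eventually_mono\<close>)

text \<open>Appending a state to a path appends one factor to the product in
  \<open>prob_path\<close>; this is the Markov property with respect to the whole history.\<close>

lemma prob_path_Suc:
  "prob {\<omega> \<in> space M. path n \<omega> = l \<and> Y (Suc n) \<omega> = j} =
     prob {\<omega> \<in> space M. path n \<omega> = l} * jump_prob q (last l) j"
proof (cases "length l = Suc n")
  case True
  let ?z = "((!) l)(Suc n := j)"
  have "{\<omega> \<in> space M. path n \<omega> = l \<and> Y (Suc n) \<omega> = j} = {\<omega> \<in> space M. \<forall>k\<le>Suc n. Y k \<omega> = ?z k}"
    "{\<omega> \<in> space M. path n \<omega> = l} = {\<omega> \<in> space M. \<forall>k\<le>n. Y k \<omega> = l ! k}"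
    using True by (auto simp: path_eq_iff le_Suc_eq)
  moreover have "last l = l ! n" using True by (subst last_conv_nth) auto
  ultimately show ?thesis by (simp only: prob_path) (auto intro!: prod.cong)
qed (simp add: path_eq_iff)

text \<open>The Markov property in integrated form. The weight \<open>\<phi>\<close> may depend on
  the whole history, as the event of having avoided a state does.\<close>

lemma nn_integral_step:
  assumes "\<And>j. 0 \<le> u j"
  shows "(\<integral>\<^sup>+ \<omega>. \<phi> (path n \<omega>) * ennreal (u (Y (Suc n) \<omega>)) \<partial>M) =
    (\<integral>\<^sup>+ \<omega>. \<phi> (path n \<omega>) * ennreal (step u (Y n \<omega>)) \<partial>M)"
proof -
  define Z where "Z \<omega> = (path n \<omega>, Y (Suc n) \<omega>)" for \<omega>
  have [measurable]: "Z \<in> M \<rightarrow>\<^sub>M count_space UNIV"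
  proof (subst measurable_count_space_eq_countable, safe)
    fix l j
    have "Z -` {(l, j)} \<inter> space M = {\<omega>\<in>space M. path n \<omega> = l \<and> Y (Suc n) \<omega> = j}"
      by (auto simp: Z_def)
    also have "\<dots> \<in> sets M" by measurable
    finally show "Z -` {(l, j)} \<inter> space M \<in> sets M" .
  qed auto
  let ?F = "\<lambda>(l, j). \<phi> l * ennreal (u j)"
  have "(\<integral>\<^sup>+ \<omega>. \<phi> (path n \<omega>) * ennreal (u (Y (Suc n) \<omega>)) \<partial>M) = (\<integral>\<^sup>+ \<omega>. ?F (Z \<omega>) \<partial>M)"
    by (simp add: Z_def)
  also have "\<dots> = (\<integral>\<^sup>+ z. ?F z * emeasure M {\<omega>\<in>space M. Z \<omega> = z} \<partial>count_space UNIV)"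
    by (rule nn_integral_discrete_rv) simp
  also have "\<dots> = (\<integral>\<^sup>+ l. \<integral>\<^sup>+ j. ?F (l, j) * emeasure M {\<omega>\<in>space M. Z \<omega> = (l, j)} \<partial>count_space UNIV \<partial>count_space UNIV)"
    by (rule nn_integral_fst_count_space[symmetric])
  also have "\<dots> = (\<integral>\<^sup>+ l. (\<phi> l * ennreal (step u (last l))) * emeasure M {\<omega>\<in>space M. path n \<omega> = l} \<partial>count_space UNIV)"
  proof (rule nn_integral_cong)
    fix l
    have "(\<integral>\<^sup>+ j. ?F (l, j) * emeasure M {\<omega>\<in>space M. Z \<omega> = (l, j)} \<partial>count_space UNIV) =
      (\<integral>\<^sup>+ j. (\<phi> l * emeasure M {\<omega>\<in>space M. path n \<omega> = l}) *
          (ennreal (jump_prob q (last l) j) * ennreal (u j)) \<partial>count_space UNIV)"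
      by (intro nn_integral_cong)
        (simp add: Z_def emeasure_eq_measure prob_path_Suc ennreal_mult jump_prob_nonneg mult_ac)
    also have "\<dots> = (\<phi> l * emeasure M {\<omega>\<in>space M. path n \<omega> = l}) * ennreal (step u (last l))"
      by (subst nn_integral_cmult) (auto simp: nn_integral_jump_prob assms)
    finally show "(\<integral>\<^sup>+ j. ?F (l, j) * emeasure M {\<omega>\<in>space M. Z \<omega> = (l, j)} \<partial>count_space UNIV) =
       (\<phi> l * ennreal (step u (last l))) * emeasure M {\<omega>\<in>space M. path n \<omega> = l}"
      by (simp add: mult_ac)
  qed
  also have "\<dots> = (\<integral>\<^sup>+ \<omega>. \<phi> (path n \<omega>) * ennreal (step u (last (path n \<omega>))) \<partial>M)"
    by (rule nn_integral_discrete_rv[symmetric]) simp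
  finally show ?thesis by (simp add: last_path)
qed

section \<open>Holding times and non-explosion\<close>

text \<open>The cylinder formula knows only tails \<open>t k < H k\<close>. An interval from 0 to
  \<open>t m\<close> is the tail at 0 minus the tail at \<open>t m\<close>, so the event for
  \<open>insert m B\<close> is a difference of two events for \<open>B\<close>, whose probabilities
  differ only in the factor at \<open>m\<close>.\<close>

lemma cylinder_mixed:
  assumes "finite B" "B \<subseteq> {..<n}" "\<And>k. k < n \<Longrightarrow> 0 \<le> t k"
  shows "prob {\<omega> \<in> space M. (\<forall>k\<le>n. Y k \<omega> = z k) \<and>
      (\<forall>k<n. if k \<in> B then 0 < H k \<omega> \<and> H k \<omega> \<le> t k else t k < H k \<omega>)} =
    (if z 0 = i then 1 else 0) * (\<Prod>k<n. jump_prob q (z k) (z (Suc k)) *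
      (if k \<in> B then 1 - exp (- exit_rate q (z k) * t k) else exp (- exit_rate q (z k) * t k)))"
  using assms
proof (induction B arbitrary: t)
  case empty
  then show ?case using cylinder[of n t z] by simp
next
  case (insert m B)
  let ?E = "\<lambda>B t. {\<omega> \<in> space M. (\<forall>k\<le>n. Y k \<omega> = z k) \<and>
      (\<forall>k<n. if k \<in> B then 0 < H k \<omega> \<and> H k \<omega> \<le> t k else t k < H k \<omega>)}"
  let ?f = "\<lambda>B t k. jump_prob q (z k) (z (Suc k)) *
      (if k \<in> B then 1 - exp (- exit_rate q (z k) * t k) else exp (- exit_rate q (z k) * t k))"
  let ?t = "t(m := 0)"
  let ?c = "if z 0 = i then 1 else 0 :: real"
  have m: "m < n" "m \<notin> B" "B \<subseteq> {..<n}" "0 \<le> t m" using insert by auto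
  have sets: "?E B t \<in> sets M" "?E B ?t \<in> sets M" by measurable
  have sub: "?E B t \<subseteq> ?E B ?t"
  proof safe
    fix \<omega> k
    assume *: "\<forall>k<n. if k \<in> B then 0 < H k \<omega> \<and> H k \<omega> \<le> t k else t k < H k \<omega>" "k < n"
    then show "if k \<in> B then 0 < H k \<omega> \<and> H k \<omega> \<le> ?t k else ?t k < H k \<omega>"
      using m by (cases "k = m") (auto dest: spec[of _ m])
  qed
  have eq: "?E (insert m B) t = ?E B ?t - ?E B t"
  proof (intro set_eqI iffI)
    fix \<omega> assume *: "\<omega> \<in> ?E (insert m B) t"
    then have "\<not> t m < H m \<omega>" using m(1) by fastforce
    then have "\<omega> \<notin> ?E B t" using m(1,2) by auto
    moreover have "\<omega> \<in> ?E B ?t" using * m(1,2) by (auto split: if_splits)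
    ultimately show "\<omega> \<in> ?E B ?t - ?E B t" by blast
  next
    fix \<omega> assume *: "\<omega> \<in> ?E B ?t - ?E B t"
    then have "\<omega> \<in> ?E B ?t" by blast
    then have Y: "\<omega> \<in> space M" "\<forall>k\<le>n. Y k \<omega> = z k"
      and t: "\<And>k. k < n \<Longrightarrow> if k \<in> B then 0 < H k \<omega> \<and> H k \<omega> \<le> ?t k else ?t k < H k \<omega>"
      by blast+
    have "\<not> t m < H m \<omega>"
    proof
      assume "t m < H m \<omega>"
      then have "\<forall>k<n. if k \<in> B then 0 < H k \<omega> \<and> H k \<omega> \<le> t k else t k < H k \<omega>"
        using t m(2) by (metis fun_upd_apply)
      then have "\<omega> \<in> ?E B t" using Y by blast
      then show False using * by blast
    qed
    then have "if k \<in> insert m B then 0 < H k \<omega> \<and> H k \<omega> \<le> t k else t k < H k \<omega>" if "k < n" for k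
      using t[OF that] m(2) by (auto split: if_splits)
    then show "\<omega> \<in> ?E (insert m B) t" using Y by blast
  qed
  have split: "(\<Prod>k<n. ?f B' t' k) = ?f B' t' m * (\<Prod>k\<in>{..<n}-{m}. ?f B' t' k)" for B' t'
    using m(1) by (intro prod.remove) auto
  have other: "(\<Prod>k\<in>{..<n}-{m}. ?f (insert m B) t k) = (\<Prod>k\<in>{..<n}-{m}. ?f B t k)"
      "(\<Prod>k\<in>{..<n}-{m}. ?f B ?t k) = (\<Prod>k\<in>{..<n}-{m}. ?f B t k)"
    using m(2) by (auto intro!: prod.cong simp: fun_upd_apply split: if_splits)
  have "prob (?E (insert m B) t) = prob (?E B ?t) - prob (?E B t)"
    unfolding eq by (rule finite_measure_Diff) (use sets sub in auto)
  also have "\<dots> = ?c * (\<Prod>k<n. ?f B ?t k) - ?c * (\<Prod>k<n. ?f B t k)"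
    using insert.IH[of t] insert.IH[of ?t] insert.prems m by simp
  also have "\<dots> = ?c * (\<Prod>k<n. ?f (insert m B) t k)"
    unfolding split other using m(2) by (simp add: algebra_simps)
  finally show ?case .
qed

text \<open>Given the path, the holding times are independent, and each is at most 1 with
  probability at most \<open>1 - exp (- hi)\<close>. This bound is the same for all paths.\<close>

lemma prob_short_holding:
  "prob {\<omega> \<in> space M. \<forall>k\<in>{m..<n}. H k \<omega> \<le> 1} \<le> (1 - exp (- hi)) ^ (n - m)"
proof -
  let ?A = "{\<omega> \<in> space M. \<forall>k\<in>{m..<n}. H k \<omega> \<le> 1}"
  let ?\<rho> = "1 - exp (- hi)"
  have \<rho>: "0 \<le> ?\<rho>" using exit_rate_bounds(4) by simp
  have "prob {\<omega>\<in>?A. path n \<omega> = l} \<le> ?\<rho> ^ (n - m) * prob {\<omega>\<in>space M. path n \<omega> = l}" for l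
  proof (cases "length l = Suc n")
    case True
    \<comment> \<open>Outside \<open>{m..<n}\<close> the threshold 0 leaves only the condition
      \<open>0 < H k\<close>, which holds almost surely.\<close>
    let ?z = "(!) l" and ?t = "\<lambda>k. if k \<in> {m..<n} then 1 else 0 :: real"
    let ?p = "\<lambda>k. jump_prob q (?z k) (?z (Suc k))"
    let ?c = "if ?z 0 = i then 1 else 0 :: real"
    have "prob {\<omega>\<in>?A. path n \<omega> = l} = prob {\<omega> \<in> space M. (\<forall>k\<le>n. Y k \<omega> = ?z k) \<and>
      (\<forall>k<n. if k \<in> {m..<n} then 0 < H k \<omega> \<and> H k \<omega> \<le> ?t k else ?t k < H k \<omega>)}"
      by (rule measure_eq_AE) (use AE_H_pos True in \<open>auto simp: path_eq_iff elim!: eventually_mono split: if_splits\<close>)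
    also have "\<dots> = ?c * (\<Prod>k<n. ?p k *
      (if k \<in> {m..<n} then 1 - exp (- exit_rate q (?z k) * ?t k) else exp (- exit_rate q (?z k) * ?t k)))"
      by (rule cylinder_mixed) auto
    also have "\<dots> \<le> ?c * (\<Prod>k<n. ?p k * (if k \<in> {m..<n} then ?\<rho> else 1))"
      using exit_rate_bounds by (intro mult_left_mono prod_mono conjI) (auto simp: jump_prob_nonneg less_imp_le intro!: mult_left_mono mult_nonneg_nonneg)
    also have "\<dots> = ?c * (\<Prod>k<n. ?p k) * (\<Prod>k<n. if k \<in> {m..<n} then ?\<rho> else 1)"
      by (simp add: prod.distrib)
    also have "(\<Prod>k<n. if k \<in> {m..<n} then ?\<rho> else 1) = ?\<rho> ^ (n - m)"
    proof -
      have "(\<Prod>k<n. if k \<in> {m..<n} then ?\<rho> else 1) = (\<Prod>k\<in>{..<n} \<inter> {m..<n}. ?\<rho>)"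
        by (rule prod.inter_restrict[symmetric]) simp
      moreover have "{..<n} \<inter> {m..<n} = {m..<n}" by auto
      ultimately show ?thesis by simp
    qed
    also have "?c * (\<Prod>k<n. ?p k) = prob {\<omega>\<in>space M. path n \<omega> = l}"
      using True by (simp add: path_eq_iff prob_path)
    finally show ?thesis by (simp add: mult.commute)
  qed (simp add: path_eq_iff)
  then have "prob {\<omega>\<in>?A. True} \<le> ?\<rho> ^ (n - m) * prob {\<omega>\<in>space M. True}"
    by (intro prob_dominated_discrete_rv[where Z = "path n" and Q = "\<lambda>_. True"]) (use \<rho> in auto)
  then show ?thesis by (simp add: prob_space)
qed

text \<open>Infinitely many holding times above 1, all others being positive, push the jump times to
  infinity; the distribution of their sums never has to be computed.\<close>

lemma AE_long_holding: "AE \<omega> in M. \<forall>m. \<exists>k\<ge>m. 1 < H k \<omega>"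
proof -
  have "AE \<omega> in M. \<exists>k\<ge>m. 1 < H k \<omega>" for m
  proof -
    let ?A = "{\<omega> \<in> space M. \<forall>k\<ge>m. H k \<omega> \<le> 1}"
    have "prob ?A \<le> (1 - exp (- hi)) ^ n" for n
    proof -
      have "prob ?A \<le> prob {\<omega> \<in> space M. \<forall>k\<in>{m..<m + n}. H k \<omega> \<le> 1}"
        by (rule finite_measure_mono) auto
      also have "\<dots> \<le> (1 - exp (- hi)) ^ n" using prob_short_holding[of m "m + n"] by simp
      finally show ?thesis .
    qed
    moreover have "(\<lambda>n. (1 - exp (- hi)) ^ n) \<longlonglongrightarrow> 0"
      using exit_rate_bounds(4) by (intro LIMSEQ_realpow_zero) auto
    ultimately have "prob ?A \<le> 0" by (intro LIMSEQ_le_const) auto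
    then have "prob ?A = 0" by (simp add: antisym)
    then have "AE \<omega> in M. \<omega> \<notin> ?A"
      by (intro AE_not_in) (auto simp: emeasure_eq_measure null_sets_def)
    then show ?thesis by (auto elim!: AE_mp simp: not_le)
  qed
  then show ?thesis by (simp add: AE_all_countable)
qed

lemma AE_nonexplosive: "AE \<omega> in M. \<forall>t. \<exists>n. t < (\<Sum>k<n. H k \<omega>)"
  using AE_long_holding AE_H_pos
proof eventually_elim
  fix \<omega> assume long: "\<forall>m. \<exists>k\<ge>m. 1 < H k \<omega>" and pos: "\<forall>k. 0 < H k \<omega>"
  have "\<exists>n. real m < (\<Sum>k<n. H k \<omega>)" for m
  proof (induction m)
    case 0
    then show ?case using pos by (auto intro!: exI[of _ 1])
  next
    case (Suc m)
    then obtain n where n: "real m < (\<Sum>k<n. H k \<omega>)" by auto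
    obtain k where k: "n \<le> k" "1 < H k \<omega>" using long by auto
    have "(\<Sum>j<n. H j \<omega>) \<le> (\<Sum>j<k. H j \<omega>)"
      using pos k by (intro sum_mono2) (auto intro: less_imp_le)
    then have "real (Suc m) < (\<Sum>j<Suc k. H j \<omega>)" using n k by simp
    then show ?case by blast
  qed
  then show "\<forall>t. \<exists>n. t < (\<Sum>k<n. H k \<omega>)"
    by (meson less_trans reals_Archimedean2)
qed

lemma prob_long_holding:
  "prob {\<omega> \<in> space M. Q (path n \<omega>) \<and> real m < H n \<omega>} \<le> exp (- lo) ^ m * prob {\<omega> \<in> space M. Q (path n \<omega>)}"
proof -
  let ?A = "{\<omega> \<in> space M. real m < H n \<omega>}"
  have "prob {\<omega>\<in>?A. path n \<omega> = l} \<le> exp (- lo) ^ m * prob {\<omega>\<in>space M. path n \<omega> = l}" for l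
  proof (cases "length l = Suc n")
    case True
    let ?B = "{\<omega> \<in> space M. (\<forall>k\<le>n. Y k \<omega> = l ! k) \<and> (\<forall>k<n. 0 < H k \<omega>)}"
    have e: "exp (- exit_rate q (l ! n) * real m) \<le> exp (- lo) ^ m"
      using exit_rate_bounds(1)[of "l ! n"] by (simp add: mult_left_mono mult.commute[of "exit_rate q (l ! n)"] flip: exp_of_nat_mult)
    have "prob {\<omega>\<in>?A. path n \<omega> = l} =
        prob {\<omega> \<in> space M. (\<forall>k\<le>n. Y k \<omega> = l ! k) \<and> (\<forall>k<n. 0 < H k \<omega>) \<and> real m < H n \<omega>}"
      by (rule measure_eq_AE) (use AE_H_pos True in \<open>auto simp: path_eq_iff elim!: eventually_mono\<close>)
    also have "\<dots> = prob ?B * exp (- exit_rate q (l ! n) * real m)"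
      by (rule cylinder_last) simp
    also have "\<dots> \<le> prob ?B * exp (- lo) ^ m"
      using e by (rule mult_left_mono) simp
    also have "prob ?B = prob {\<omega>\<in>space M. path n \<omega> = l}"
      using True by (simp add: path_eq_iff prob_path cylinder_zero)
    finally show ?thesis by (simp add: mult.commute)
  qed (simp add: path_eq_iff)
  then have "prob {\<omega>\<in>?A. Q (path n \<omega>)} \<le> exp (- lo) ^ m * prob {\<omega>\<in>space M. Q (path n \<omega>)}"
    by (intro prob_dominated_discrete_rv[where Z = "path n" and Q = Q]) auto
  moreover have "{\<omega>\<in>?A. Q (path n \<omega>)} = {\<omega> \<in> space M. Q (path n \<omega>) \<and> real m < H n \<omega>}"
    by auto
  ultimately show ?thesis by simp
qed

text \<open>The mean is at most the sum of the tails at the integers \<open>m\<close>, and the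
  bounds \<open>exp (- lo) ^ m\<close> have the stated geometric sum. The event may involve the
  state \<open>Y n\<close> in which \<open>H n\<close> is spent, because the tail bound is uniform
  in the path.\<close>

lemma nn_integral_holding:
  "(\<integral>\<^sup>+ \<omega>. ennreal (H n \<omega>) * indicator {\<omega> \<in> space M. Q (path n \<omega>)} \<omega> \<partial>M)
    \<le> ennreal (1 / (1 - exp (- lo))) * emeasure M {\<omega> \<in> space M. Q (path n \<omega>)}"
proof -
  let ?Q = "{\<omega> \<in> space M. Q (path n \<omega>)}"
  let ?E = "\<lambda>m. {\<omega> \<in> space M. Q (path n \<omega>) \<and> real m < H n \<omega>}"
  have le: "ennreal h \<le> (\<Sum>m. indicator {m. real m < h} m)" for h
  proof -
    have "ennreal h \<le> ennreal (real (nat \<lceil>h\<rceil>))"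
      by (intro ennreal_leI) linarith
    also have "\<dots> = (\<Sum>m<nat \<lceil>h\<rceil>. 1)" by (simp add: ennreal_of_nat_eq_real_of_nat)
    also have "\<dots> = (\<Sum>m<nat \<lceil>h\<rceil>. indicator {m. real m < h} m)"
      by (intro sum.cong) (auto simp: indicator_def, linarith)
    also have "\<dots> \<le> (\<Sum>m. indicator {m. real m < h} m)"
      by (intro sum_le_suminf) auto
    finally show ?thesis .
  qed
  have "(\<integral>\<^sup>+ \<omega>. ennreal (H n \<omega>) * indicator ?Q \<omega> \<partial>M) \<le> (\<integral>\<^sup>+ \<omega>. (\<Sum>m. indicator (?E m) \<omega>) \<partial>M)"
  proof (rule nn_integral_mono)
    fix \<omega> assume "\<omega> \<in> space M"
    then have "(\<Sum>m. indicator (?E m) \<omega> :: ennreal) = (\<Sum>m. indicator {m. real m < H n \<omega>} m) * indicator ?Q \<omega>"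
      by (auto simp: indicator_def)
    then show "ennreal (H n \<omega>) * indicator ?Q \<omega> \<le> (\<Sum>m. indicator (?E m) \<omega>)"
      using le[of "H n \<omega>"] by (simp add: mult_right_mono)
  qed
  also have "\<dots> = (\<Sum>m. emeasure M (?E m))"
    by (subst nn_integral_suminf) auto
  also have "\<dots> \<le> (\<Sum>m. ennreal (exp (- lo) ^ m) * emeasure M ?Q)"
    by (intro suminf_le) (auto simp: emeasure_eq_measure ennreal_mult[symmetric] prob_long_holding intro!: ennreal_leI)
  also have "\<dots> = (\<Sum>m. ennreal (exp (- lo) ^ m)) * emeasure M ?Q"
    by simp
  also have "(\<Sum>m. ennreal (exp (- lo) ^ m)) = ennreal (1 / (1 - exp (- lo)))"
    using lo_pos by (intro suminf_ennreal_eq geometric_sums) auto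
  finally show ?thesis .
qed

section \<open>Visits to the initial state\<close>

lemma AE_start: "AE \<omega> in M. Y 0 \<omega> = i"
proof -
  have "prob {\<omega> \<in> space M. Y 0 \<omega> = i} = 1"
    using prob_path[of 0 "\<lambda>_. i"] by simp
  then show ?thesis by (subst (asm) prob_eq_1) (auto elim!: AE_mp)
qed

text \<open>A jump never leads back to its own state, as \<open>jump_prob q i i = 0\<close>. Hence
  the path has left \<open>i\<close> after one jump, as the definition of \<open>return_time\<close>
  demands.\<close>

lemma AE_leave: "AE \<omega> in M. Y 1 \<omega> \<noteq> i"
proof -
  have "prob {\<omega> \<in> space M. \<forall>k\<le>1. Y k \<omega> = i} = 0"
    unfolding prob_path[of 1 "\<lambda>_. i"] by (simp add: jump_prob_def)
  then have "AE \<omega> in M. \<omega> \<notin> {\<omega> \<in> space M. \<forall>k\<le>1. Y k \<omega> = i}"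
    by (intro AE_not_in) (auto simp: emeasure_eq_measure null_sets_def)
  with AE_start AE_space show ?thesis
  proof eventually_elim
    fix \<omega> assume *: "Y 0 \<omega> = i" "\<omega> \<in> space M" "\<omega> \<notin> {\<omega> \<in> space M. \<forall>k\<le>1. Y k \<omega> = i}"
    then obtain k where "k \<le> 1" "Y k \<omega> \<noteq> i" by blast
    then show "Y 1 \<omega> \<noteq> i" using *(1) by (cases k) auto
  qed
qed

lemma nn_integral_start: "(\<integral>\<^sup>+ \<omega>. f (Y 0 \<omega>) \<partial>M) = f i"
proof -
  have "(\<integral>\<^sup>+ \<omega>. f (Y 0 \<omega>) \<partial>M) = (\<integral>\<^sup>+ \<omega>. f i \<partial>M)"
    by (rule nn_integral_cong_AE) (use AE_start in eventually_elim, simp)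
  then show ?thesis by (simp add: emeasure_space_1)
qed

text \<open>Iterating the contraction bounds the mean of \<open>g (Y n)\<close> by
  \<open>\<beta> ^ n * g i\<close>. Start and target are the same state, so Markov's inequality
  cancels \<open>g i\<close> and leaves \<open>\<beta> ^ n\<close> for the probability of being in
  \<open>i\<close>, which is summable; Borel-Cantelli applies.\<close>

lemma AE_finitely_many_visits:
  assumes g_pos: "\<And>z. 0 < g z" and contr: "\<And>z. step g z \<le> \<beta> * g z" and \<beta>: "0 \<le> \<beta>" "\<beta> < 1"
  shows "AE \<omega> in M. \<forall>\<^sub>F n in sequentially. Y n \<omega> \<noteq> i"
proof -
  have g_nonneg: "0 \<le> g z" for z using g_pos[of z] by simp
  have D: "(\<integral>\<^sup>+ \<omega>. ennreal (g (Y n \<omega>)) \<partial>M) \<le> ennreal (\<beta> ^ n * g i)" for n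
  proof (induction n)
    case 0
    then show ?case by (simp add: nn_integral_start[of "\<lambda>z. ennreal (g z)"])
  next
    case (Suc n)
    have "(\<integral>\<^sup>+ \<omega>. ennreal (g (Y (Suc n) \<omega>)) \<partial>M) = (\<integral>\<^sup>+ \<omega>. ennreal (step g (Y n \<omega>)) \<partial>M)"
      using nn_integral_step[of g "\<lambda>_. 1" n] g_nonneg by simp
    also have "\<dots> \<le> (\<integral>\<^sup>+ \<omega>. ennreal \<beta> * ennreal (g (Y n \<omega>)) \<partial>M)"
      using contr \<beta> g_nonneg by (intro nn_integral_mono) (simp add: ennreal_mult[symmetric] ennreal_leI)
    also have "\<dots> = ennreal \<beta> * (\<integral>\<^sup>+ \<omega>. ennreal (g (Y n \<omega>)) \<partial>M)"
      by (rule nn_integral_cmult) measurable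
    also have "\<dots> \<le> ennreal \<beta> * ennreal (\<beta> ^ n * g i)"
      by (intro mult_left_mono Suc) simp
    also have "\<dots> = ennreal (\<beta> ^ Suc n * g i)"
      using \<beta> g_nonneg by (simp add: ennreal_mult[symmetric] mult.assoc)
    finally show ?case .
  qed
  have P: "prob {\<omega> \<in> space M. Y n \<omega> = i} \<le> \<beta> ^ n" for n
  proof -
    have "ennreal (prob {\<omega> \<in> space M. Y n \<omega> = i} * g i) =
        (\<integral>\<^sup>+ \<omega>. ennreal (g i) * indicator {\<omega> \<in> space M. Y n \<omega> = i} \<omega> \<partial>M)"
      using g_nonneg by (simp add: nn_integral_cmult_indicator emeasure_eq_measure ennreal_mult[symmetric] mult.commute)
    also have "\<dots> \<le> (\<integral>\<^sup>+ \<omega>. ennreal (g (Y n \<omega>)) \<partial>M)"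
      by (intro nn_integral_mono) (auto simp: indicator_def)
    also have "\<dots> \<le> ennreal (\<beta> ^ n * g i)" by (rule D)
    finally have "prob {\<omega> \<in> space M. Y n \<omega> = i} * g i \<le> \<beta> ^ n * g i"
      using \<beta> g_nonneg by (subst (asm) ennreal_le_iff) auto
    then show ?thesis using g_pos[of i] by simp
  qed
  have "AE \<omega> in M. \<forall>\<^sub>F n in sequentially. \<omega> \<in> space M - {\<omega> \<in> space M. Y n \<omega> = i}"
  proof (rule borel_cantelli_AE1)
    show "summable (\<lambda>n. prob {\<omega> \<in> space M. Y n \<omega> = i})"
      using P \<beta> by (intro summable_comparison_test'[OF summable_geometric[of \<beta>], of 0]) auto
  qed (auto simp: emeasure_eq_measure)
  then show ?thesis by (rule AE_mp) (auto elim: eventually_mono)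
qed

text \<open>The path \<open>X\<close> is tied to \<open>Y\<close> only before an explosion. As there
  is none, every time beyond \<open>?S n0\<close> lies in a holding interval whose state is not
  \<open>i\<close>.\<close>

lemma AE_bounded_visit_times:
  assumes X: "AE \<omega> in M. \<forall>n t. (\<Sum>k<n. H k \<omega>) \<le> t \<and> t < (\<Sum>k<Suc n. H k \<omega>) \<longrightarrow> X t \<omega> = Y n \<omega>"
    and fin: "AE \<omega> in M. \<forall>\<^sub>F n in sequentially. Y n \<omega> \<noteq> i"
  shows "AE \<omega> in M. bdd_above {t. 0 \<le> t \<and> X t \<omega> = i}"
  using X fin AE_nonexplosive AE_H_pos
proof eventually_elim
  fix \<omega>
  let ?S = "\<lambda>n. \<Sum>k<n. H k \<omega>"
  assume X: "\<forall>n t. ?S n \<le> t \<and> t < ?S (Suc n) \<longrightarrow> X t \<omega> = Y n \<omega>"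
    and fin: "\<forall>\<^sub>F n in sequentially. Y n \<omega> \<noteq> i"
    and unb: "\<forall>t. \<exists>n. t < ?S n" and pos: "\<forall>k. 0 < H k \<omega>"
  obtain n0 where n0: "\<And>n. n \<ge> n0 \<Longrightarrow> Y n \<omega> \<noteq> i"
    using fin by (auto simp: eventually_sequentially)
  have mono: "?S m \<le> ?S n" if "m \<le> n" for m n
    using that pos by (intro sum_mono2) (auto intro: less_imp_le)
  show "bdd_above {t. 0 \<le> t \<and> X t \<omega> = i}"
  proof (rule bdd_aboveI[where M = "?S n0"], rule ccontr)
    fix t assume t: "t \<in> {t. 0 \<le> t \<and> X t \<omega> = i}" "\<not> t \<le> ?S n0"
    obtain n where n: "t < ?S n" "\<And>m. m < n \<Longrightarrow> \<not> t < ?S m"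
      using unb exists_least_iff[of "\<lambda>n. t < ?S n"] by blast
    have "n \<noteq> 0" using n(1) t by (intro notI) simp
    then obtain m where m: "n = Suc m" using not0_implies_Suc by blast
    have "n0 < n" using n(1) t mono[of n n0] by force
    then have "Y m \<omega> \<noteq> i" using m by (intro n0) simp
    moreover have "X t \<omega> = Y m \<omega>" using X n[unfolded m] by (auto simp: not_less)
    ultimately show False using t by simp
  qed
qed

section \<open>Mean return time\<close>

text \<open>The event that the first return of the jump chain comes after step \<open>n\<close>.
  Index 0 is left out because the chain starts in \<open>i\<close>. The sum of the probabilities
  over \<open>n\<close> is the mean number of steps until the return.\<close>

definition avoided :: "nat \<Rightarrow> 'w set" where
  "avoided n = {\<omega> \<in> space M. \<forall>k\<in>{1..n}. Y k \<omega> \<noteq> i}"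

lemma avoided_path: "avoided n = {\<omega> \<in> space M. \<forall>k\<in>{1..<length (path n \<omega>)}. path n \<omega> ! k \<noteq> i}"
proof -
  have "{1..<length (path n \<omega>)} = {1..n}" for \<omega>
    using path_eq_iff[of n \<omega> "path n \<omega>"] by auto
  then show ?thesis by (auto simp: avoided_def nth_path)
qed

lemma avoided_measurable[measurable]: "avoided n \<in> sets M"
  unfolding avoided_def by measurable

text \<open>Setting the function to 0 at \<open>i\<close> encodes killing. The mean
  \<open>D n\<close> of \<open>V (Y n)\<close> on \<open>avoided n\<close> drops in each step by at
  least the probability of \<open>avoided n\<close>, and the total loss cannot exceed
  \<open>D 0 = V i\<close>.\<close>

lemma sum_prob_avoided:
  assumes V_nonneg: "\<And>z. 0 \<le> V z"
    and drift: "\<And>z. step (\<lambda>j. if j = i then 0 else V j) z \<le> V z - 1"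
  shows "(\<Sum>n. emeasure M (avoided n)) \<le> ennreal (V i)"
proof -
  let ?u = "\<lambda>j. if j = i then 0 else V j"
  define D where "D n = (\<integral>\<^sup>+ \<omega>. ennreal (V (Y n \<omega>)) * indicator (avoided n) \<omega> \<partial>M)" for n
  have D_Suc: "D (Suc n) + emeasure M (avoided n) \<le> D n" for n
  proof -
    let ?\<phi> = "indicator {l. \<forall>k\<in>{1..<length l}. l ! k \<noteq> i} :: 's list \<Rightarrow> ennreal"
    have \<phi>: "?\<phi> (path n \<omega>) = indicator (avoided n) \<omega>" if "\<omega> \<in> space M" for \<omega>
      using that by (auto simp: avoided_path indicator_def)
    have "D (Suc n) = (\<integral>\<^sup>+ \<omega>. ?\<phi> (path n \<omega>) * ennreal (?u (Y (Suc n) \<omega>)) \<partial>M)"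
      unfolding D_def
    proof (rule nn_integral_cong)
      fix \<omega> assume "\<omega> \<in> space M"
      then show "ennreal (V (Y (Suc n) \<omega>)) * indicator (avoided (Suc n)) \<omega> =
          ?\<phi> (path n \<omega>) * ennreal (?u (Y (Suc n) \<omega>))"
        unfolding \<phi>[OF \<open>\<omega> \<in> space M\<close>] by (auto simp: avoided_def indicator_def atLeastAtMostSuc_conv)
    qed
    also have "\<dots> = (\<integral>\<^sup>+ \<omega>. ?\<phi> (path n \<omega>) * ennreal (step ?u (Y n \<omega>)) \<partial>M)"
      by (rule nn_integral_step) (simp add: V_nonneg)
    also have "\<dots> = (\<integral>\<^sup>+ \<omega>. ennreal (step ?u (Y n \<omega>)) * indicator (avoided n) \<omega> \<partial>M)"
      by (intro nn_integral_cong) (simp only: \<phi> mult.commute)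
    finally have "D (Suc n) + emeasure M (avoided n) =
       (\<integral>\<^sup>+ \<omega>. ennreal (step ?u (Y n \<omega>)) * indicator (avoided n) \<omega> + indicator (avoided n) \<omega> \<partial>M)"
      by (simp add: nn_integral_add)
    also have "\<dots> \<le> D n"
      unfolding D_def
    proof (rule nn_integral_mono)
      fix \<omega>
      have "0 \<le> step ?u (Y n \<omega>)" by (rule step_nonneg) (simp add: V_nonneg)
      then have "ennreal (step ?u (Y n \<omega>)) + 1 = ennreal (step ?u (Y n \<omega>) + 1)" by simp
      also have "\<dots> \<le> ennreal (V (Y n \<omega>))" using drift[of "Y n \<omega>"] by (intro ennreal_leI) simp
      finally show "ennreal (step ?u (Y n \<omega>)) * indicator (avoided n) \<omega> + indicator (avoided n) \<omega>
        \<le> ennreal (V (Y n \<omega>)) * indicator (avoided n) \<omega>"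
        by (auto simp: indicator_def)
    qed
    finally show ?thesis .
  qed
  have "D n + (\<Sum>k<n. emeasure M (avoided k)) \<le> D 0" for n
  proof (induction n)
    case (Suc n)
    have "D (Suc n) + (\<Sum>k<Suc n. emeasure M (avoided k)) =
        (D (Suc n) + emeasure M (avoided n)) + (\<Sum>k<n. emeasure M (avoided k))"
      by (simp add: add_ac)
    also have "\<dots> \<le> D n + (\<Sum>k<n. emeasure M (avoided k))" by (intro add_right_mono D_Suc)
    finally show ?case using Suc by (rule order_trans)
  qed simp
  moreover have "D 0 = ennreal (V i)"
  proof -
    have "D 0 = (\<integral>\<^sup>+ \<omega>. ennreal (V (Y 0 \<omega>)) \<partial>M)"
      unfolding D_def by (intro nn_integral_cong) (auto simp: avoided_def)
    then show ?thesis by (simp add: nn_integral_start[of "\<lambda>z. ennreal (V z)"])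
  qed
  ultimately have le: "D n + (\<Sum>k<n. emeasure M (avoided k)) \<le> ennreal (V i)" for n by simp
  have "(\<Sum>k<n. emeasure M (avoided k)) \<le> ennreal (V i)" for n
    by (rule order_trans[OF _ le[of n]]) (simp add: add_increasing)
  then show ?thesis by (intro suminf_le_const summableI)
qed

text \<open>If the return happens at step \<open>n\<close>, every \<open>k < n\<close> satisfies
  \<open>avoided k\<close>, so the sum of the \<open>H k\<close> over such \<open>k\<close>
  dominates the return time. Whether \<open>avoided k\<close> holds is decided by the path up to
  \<open>k\<close>, hence each mean is at most the constant \<open>?c\<close> times the probability
  of \<open>avoided k\<close>.\<close>

lemma return_time_integrable:
  assumes X: "AE \<omega> in M. \<forall>n t. (\<Sum>k<n. H k \<omega>) \<le> t \<and> t < (\<Sum>k<Suc n. H k \<omega>) \<longrightarrow> X t \<omega> = Y n \<omega>"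
    and V_nonneg: "\<And>z. 0 \<le> V z"
    and drift: "\<And>z. step (\<lambda>j. if j = i then 0 else V j) z \<le> V z - 1"
  shows "(\<integral>\<^sup>+ \<omega>. return_time X i \<omega> \<partial>M) < \<infinity>"
proof -
  note sum_avoided = sum_prob_avoided[of V, OF V_nonneg drift]
  have "AE \<omega> in M. \<forall>\<^sub>F n in sequentially. \<omega> \<in> space M - avoided n"
  proof (rule borel_cantelli_AE1)
    have "(\<Sum>n. ennreal (prob (avoided n))) < \<top>"
      using sum_avoided by (simp add: emeasure_eq_measure le_less_trans ennreal_less_top)
    then show "summable (\<lambda>n. prob (avoided n))"
      by (intro summable_suminf_not_top) auto
  qed (auto simp: emeasure_eq_measure)
  then have returns: "AE \<omega> in M. \<exists>n\<ge>1. Y n \<omega> = i"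
  proof eventually_elim
    fix \<omega> assume "\<forall>\<^sub>F n in sequentially. \<omega> \<in> space M - avoided n"
    then obtain n where "\<omega> \<in> space M - avoided n"
      by (auto simp: eventually_sequentially)
    then show "\<exists>n\<ge>1. Y n \<omega> = i" by (auto simp: avoided_def)
  qed
  have le: "AE \<omega> in M. return_time X i \<omega> \<le> (\<Sum>n. ennreal (H n \<omega>) * indicator (avoided n) \<omega>)"
    using X returns AE_leave AE_H_pos AE_space
  proof eventually_elim
    fix \<omega>
    let ?S = "\<lambda>n. \<Sum>k<n. H k \<omega>"
    assume X: "\<forall>n t. ?S n \<le> t \<and> t < ?S (Suc n) \<longrightarrow> X t \<omega> = Y n \<omega>"
      and ret: "\<exists>n\<ge>1. Y n \<omega> = i" and leave: "Y 1 \<omega> \<noteq> i" and pos: "\<forall>k. 0 < H k \<omega>" and \<omega>: "\<omega> \<in> space M"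
    obtain n where n: "1 \<le> n" "Y n \<omega> = i" "\<And>m. m < n \<Longrightarrow> \<not> (1 \<le> m \<and> Y m \<omega> = i)"
      using ret exists_least_iff[of "\<lambda>n. 1 \<le> n \<and> Y n \<omega> = i"] by blast
    have X_S: "X (?S m) \<omega> = Y m \<omega>" for m
      using X[rule_format, of m "?S m"] pos by simp
    \<comment> \<open>The return index is at least 2, so the first jump time \<open>?S 1\<close> is
      a time before the return at which the path is away from \<open>i\<close>.\<close>
    have "1 < n" using n(1,2) leave by (cases "n = 1") auto
    then have "?S 1 < ?S n" using pos by (intro sum_strict_mono2[of _ _ 1]) (auto intro: less_imp_le)
    moreover have "0 \<le> ?S 1" using pos by (simp add: less_imp_le)
    moreover have "X (?S n) \<omega> = i" "X (?S 1) \<omega> \<noteq> i"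
      using X_S[of n] X_S[of 1] n(2) leave by simp_all
    ultimately have "ennreal (?S n) \<in> {ennreal t | t. X t \<omega> = i \<and> (\<exists>s. 0 \<le> s \<and> s < t \<and> X s \<omega> \<noteq> i)}"
      by blast
    then have "return_time X i \<omega> \<le> ennreal (?S n)"
      unfolding return_time_def by (rule Inf_lower)
    also have "\<dots> = (\<Sum>k<n. ennreal (H k \<omega>))"
      using pos by (subst sum_ennreal) (auto intro: less_imp_le)
    also have "\<dots> = (\<Sum>k<n. ennreal (H k \<omega>) * indicator (avoided k) \<omega>)"
      using n(3) \<omega> by (intro sum.cong) (auto simp: avoided_def indicator_def)
    also have "\<dots> \<le> (\<Sum>n. ennreal (H n \<omega>) * indicator (avoided n) \<omega>)"
      by (intro sum_le_suminf) auto
    finally show "return_time X i \<omega> \<le> (\<Sum>n. ennreal (H n \<omega>) * indicator (avoided n) \<omega>)" .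
  qed
  let ?c = "ennreal (1 / (1 - exp (- lo)))"
  have "(\<integral>\<^sup>+ \<omega>. return_time X i \<omega> \<partial>M) \<le> (\<integral>\<^sup>+ \<omega>. (\<Sum>n. ennreal (H n \<omega>) * indicator (avoided n) \<omega>) \<partial>M)"
    by (rule nn_integral_mono_AE[OF le])
  also have "\<dots> = (\<Sum>n. \<integral>\<^sup>+ \<omega>. ennreal (H n \<omega>) * indicator (avoided n) \<omega> \<partial>M)"
    by (rule nn_integral_suminf) measurable
  also have "\<dots> \<le> (\<Sum>n. ?c * emeasure M (avoided n))"
    unfolding avoided_path by (intro suminf_le nn_integral_holding) auto
  also have "\<dots> = ?c * (\<Sum>n. emeasure M (avoided n))" by simp
  also have "\<dots> \<le> ?c * ennreal (V i)" by (intro mult_left_mono sum_avoided) simp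
  also have "\<dots> < \<infinity>" by (simp add: ennreal_mult_less_top)
  finally show ?thesis .
qed

end

section \<open>Drift criteria\<close>

lemma (in finite_range_rates) ctmc_fromE:
  assumes "ctmc_from M q i X"
  obtains Y H where "jump_chain q N lo hi M i Y H"
    "AE \<omega> in M. \<forall>n t. (\<Sum>k<n. H k \<omega>) \<le> t \<and> t < (\<Sum>k<Suc n. H k \<omega>) \<longrightarrow> X t \<omega> = Y n \<omega>"
proof -
  from assms obtain Y H where "prob_space M" "\<forall>n. Y n \<in> M \<rightarrow>\<^sub>M count_space UNIV"
    "\<forall>n. H n \<in> borel_measurable M"
    "\<forall>n z t. (\<forall>k<n. 0 \<le> t k) \<longrightarrow>
           measure M {\<omega> \<in> space M. (\<forall>k\<le>n. Y k \<omega> = z k) \<and> (\<forall>k<n. t k < H k \<omega>)} =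
           (if z 0 = i then 1 else 0) *
           (\<Prod>k<n. jump_prob q (z k) (z (Suc k)) * exp (- exit_rate q (z k) * t k))"
    and X: "AE \<omega> in M. \<forall>n t. (\<Sum>k<n. H k \<omega>) \<le> t \<and> t < (\<Sum>k<Suc n. H k \<omega>) \<longrightarrow> X t \<omega> = Y n \<omega>"
    unfolding ctmc_from_def by blast
  then have "jump_chain q N lo hi M i Y H"
    by (intro jump_chain.intro jump_chain_axioms.intro finite_range_rates_axioms) blast+
  then show ?thesis using X that by blast
qed

section \<open>Transience criterion\<close>

lemma (in finite_range_rates) transientI:
  assumes chain: "\<And>z. ctmc_from (P z) q z X"
    and jumps: "\<And>z j. 0 < q z j \<Longrightarrow> \<bar>f j - f z\<bar> \<le> B"
    and drift: "\<And>z. \<epsilon> \<le> generator f z" and "0 < \<epsilon>"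
  shows "transient P X"
proof -
  have "0 < hi" by (rule exit_rate_bounds(4))
  \<comment> \<open>\<open>b\<close> is made at least 1 so that one can divide by it. The first
    bound in \<open>\<theta>\<close> brings the exponents into the range of
    \<open>exp_le_quadratic\<close>; the second keeps the quadratic error below half of the linear
    gain \<open>\<theta> * \<epsilon>\<close>, and \<open>\<eta>\<close> is the other half.\<close>
  define b where "b = max B 1"
  define \<theta> where "\<theta> = min (1 / b) (\<epsilon> / (2 * hi * b\<^sup>2))"
  define g where "g z = exp (- \<theta> * f z)" for z
  define \<eta> where "\<eta> = \<theta> * \<epsilon> / 2"
  have b: "1 \<le> b" "B \<le> b" by (auto simp: b_def)
  have \<theta>: "0 < \<theta>" "\<theta> * b \<le> 1" "\<theta> * (hi * b\<^sup>2) \<le> \<epsilon> / 2"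
  proof -
    show "0 < \<theta>" using b \<open>0 < \<epsilon>\<close> \<open>0 < hi\<close> by (simp add: \<theta>_def)
    have "\<theta> \<le> 1 / b" "\<theta> \<le> \<epsilon> / (2 * hi * b\<^sup>2)" by (auto simp: \<theta>_def)
    then show "\<theta> * b \<le> 1" "\<theta> * (hi * b\<^sup>2) \<le> \<epsilon> / 2"
      using b \<open>0 < hi\<close> by (auto simp: field_simps)
  qed
  have "0 < \<eta>" using \<theta> \<open>0 < \<epsilon>\<close> by (simp add: \<eta>_def)
  have gen: "generator g z \<le> - \<eta> * g z" for z
  proof -
    have "q z j * (g j - g z) \<le> g z * (- \<theta> * (q z j * (f j - f z)) + \<theta>\<^sup>2 * b\<^sup>2 * q z j)" for j
    proof (cases "q z j = 0")
      case False
      then have "0 < q z j" using q_nonneg[of z j] by simp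
      define d where "d = \<theta> * (f j - f z)"
      have d: "\<bar>d\<bar> \<le> \<theta> * b"
        using jumps[OF \<open>0 < q z j\<close>] b \<theta>(1) by (auto simp: d_def abs_mult)
      have "exp (- d) \<le> 1 + (- d) + (- d)\<^sup>2"
        using d \<theta>(2) by (intro exp_le_quadratic) auto
      also have "(- d)\<^sup>2 \<le> (\<theta> * b)\<^sup>2" using d by (simp add: abs_le_square_iff[symmetric])
      finally have "exp (- d) - 1 \<le> - d + (\<theta> * b)\<^sup>2" by simp
      moreover have "g j = g z * exp (- d)"
        by (simp add: g_def d_def exp_add[symmetric] algebra_simps)
      ultimately have "g j - g z \<le> g z * (- d + (\<theta> * b)\<^sup>2)"
        using mult_left_mono[of "exp (- d) - 1" "- d + (\<theta> * b)\<^sup>2" "g z"]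
        by (simp add: g_def algebra_simps)
      then have "q z j * (g j - g z) \<le> q z j * (g z * (- d + (\<theta> * b)\<^sup>2))"
        by (intro mult_left_mono q_nonneg)
      then show ?thesis by (simp add: d_def algebra_simps power_mult_distrib)
    qed simp
    then have "generator g z \<le> (\<Sum>j\<in>N z. g z * (- \<theta> * (q z j * (f j - f z)) + \<theta>\<^sup>2 * b\<^sup>2 * q z j))"
      unfolding generator_def by (intro sum_mono)
    also have "\<dots> = g z * (- \<theta> * generator f z + \<theta>\<^sup>2 * b\<^sup>2 * exit_rate q z)"
      by (simp only: generator_def exit_rate_eq sum.distrib flip: sum_distrib_left)
    also have "\<dots> \<le> g z * (- \<eta>)"
    proof (rule mult_left_mono)
      have "\<theta>\<^sup>2 * b\<^sup>2 * exit_rate q z \<le> \<theta>\<^sup>2 * b\<^sup>2 * hi"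
        by (intro mult_left_mono exit_rate_bounds) simp
      also have "\<dots> = \<theta> * (\<theta> * (hi * b\<^sup>2))" by (simp add: power2_eq_square)
      also have "\<dots> \<le> \<theta> * (\<epsilon> / 2)" using \<theta> by (intro mult_left_mono) auto
      finally have "\<theta>\<^sup>2 * b\<^sup>2 * exit_rate q z \<le> \<theta> * (\<epsilon> / 2)" .
      moreover have "\<theta> * \<epsilon> \<le> \<theta> * generator f z" using \<theta> drift by (intro mult_left_mono) auto
      ultimately show "- \<theta> * generator f z + \<theta>\<^sup>2 * b\<^sup>2 * exit_rate q z \<le> - \<eta>"
        by (simp add: \<eta>_def)
    qed (simp add: g_def)
    finally show ?thesis by (simp add: mult.commute)
  qed
  \<comment> \<open>Since exit rates are at most \<open>hi\<close>, a decay \<open>\<eta>\<close>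
    per unit of time is at least \<open>\<eta> / hi\<close> per jump. The maximum settles the sign
    of \<open>\<beta>\<close> without comparing \<open>\<eta>\<close> with
    \<open>hi\<close>.\<close>
  define \<beta> where "\<beta> = max 0 (1 - \<eta> / hi)"
  have contr: "step g z \<le> \<beta> * g z" for z
  proof -
    have g: "0 < g z" by (simp add: g_def)
    have "generator g z / exit_rate q z \<le> (- \<eta> * g z) / exit_rate q z"
      using gen exit_rate_bounds(3) by (intro divide_right_mono) (auto intro: less_imp_le)
    also have "\<dots> \<le> (- \<eta> * g z) / hi"
      using exit_rate_bounds(2,3)[of z] \<open>0 < \<eta>\<close> g \<open>0 < hi\<close> by (simp add: frac_le)
    finally have "step g z \<le> (1 - \<eta> / hi) * g z"
      by (simp add: step_eq_generator algebra_simps)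
    also have "\<dots> \<le> \<beta> * g z" using g by (intro mult_right_mono) (auto simp: \<beta>_def)
    finally show ?thesis .
  qed
  show ?thesis
    unfolding transient_def
  proof
    fix i
    obtain Y H where "jump_chain q N lo hi (P i) i Y H"
      and X: "AE \<omega> in P i. \<forall>n t. (\<Sum>k<n. H k \<omega>) \<le> t \<and> t < (\<Sum>k<Suc n. H k \<omega>) \<longrightarrow> X t \<omega> = Y n \<omega>"
      using ctmc_fromE[OF chain] .
    then interpret jump_chain q N lo hi "P i" i Y H by simp
    have "AE \<omega> in P i. \<forall>\<^sub>F n in sequentially. Y n \<omega> \<noteq> i"
      by (rule AE_finitely_many_visits[of g \<beta>])
        (use contr \<open>0 < \<eta>\<close> \<open>0 < hi\<close> in \<open>auto simp: g_def \<beta>_def\<close>)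
    then show "AE \<omega> in P i. bdd_above {t. 0 \<le> t \<and> X t \<omega> = i}"
      by (rule AE_bounded_visit_times[OF X])
  qed
qed

section \<open>Positive recurrence criterion\<close>

context finite_range_rates
begin

text \<open>The probability that the jump chain from \<open>z\<close> is not in \<open>i\<close> at
  any of the times 1 to \<open>n\<close>. The recursion through the transition operator defines it
  for all starting points \<open>z\<close> without a probability space for each of them.\<close>

fun avoidance :: "'s \<Rightarrow> nat \<Rightarrow> 's \<Rightarrow> real" where
  "avoidance i 0 z = 1"
| "avoidance i (Suc n) z = step (\<lambda>j. if j = i then 0 else avoidance i n j) z"

lemma avoidance_bounds: "0 \<le> avoidance i n z \<and> avoidance i n z \<le> 1"
proof (induction n arbitrary: z)
  case (Suc n)
  have "step (\<lambda>j. if j = i then 0 else avoidance i n j) z \<le> step (\<lambda>j. 1) z"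
    by (rule step_mono) (simp add: Suc)
  moreover have "0 \<le> step (\<lambda>j. if j = i then 0 else avoidance i n j) z"
    by (rule step_nonneg) (simp add: Suc)
  ultimately show ?case by (simp add: step_const)
qed simp

lemma avoidance_Suc_le: "avoidance i (Suc n) z \<le> avoidance i n z"
proof (induction n arbitrary: z)
  case 0
  then show ?case using avoidance_bounds[of i "Suc 0" z] by simp
next
  case (Suc n)
  show ?case by (subst (1 2) avoidance.simps(2), rule step_mono) (use Suc in auto)
qed

lemma avoidance_antimono: "m \<le> n \<Longrightarrow> avoidance i n z \<le> avoidance i m z"
  by (rule lift_Suc_antimono_le[of "\<lambda>n. avoidance i n z"]) (rule avoidance_Suc_le)

lemma step_less_one:
  assumes u: "\<And>j. u j \<le> 1" and "0 < q z j" "u j < 1"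
  shows "step u z < 1"
proof -
  have "j \<in> N z" using assms(2) q_outside by force
  have "step u z < step (\<lambda>_. 1) z"
    unfolding step_def
  proof (rule sum_strict_mono_ex1)
    show "\<forall>k\<in>N z. jump_prob q z k * u k \<le> jump_prob q z k * 1"
      by (intro ballI mult_left_mono u jump_prob_nonneg)
    show "\<exists>k\<in>N z. jump_prob q z k * u k < jump_prob q z k * 1"
      using \<open>j \<in> N z\<close> assms exit_rate_bounds(3)[of z]
      by (intro bexI[of _ j] mult_strict_left_mono) (auto simp: jump_prob_eq)
  qed (rule finite_N)
  then show ?thesis by (simp add: step_const)
qed

text \<open>If \<open>k\<close> jumps of positive rate lead from \<open>z\<close> to
  \<open>i\<close>, then \<open>n = k\<close> works; the induction adds one jump at a time through
  \<open>step_less_one\<close>.\<close>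

lemma avoidance_less_one:
  assumes "(z, i) \<in> {(a, b). 0 < q a b}\<^sup>+"
  shows "\<exists>n. avoidance i n z < 1"
  using assms
proof (induction rule: converse_trancl_induct)
  case (base z)
  then have "avoidance i (Suc 0) z < 1"
    by (auto intro!: step_less_one[of _ _ i])
  then show ?case ..
next
  case (step z j)
  then obtain n where "avoidance i n j < 1" by auto
  then have "avoidance i (Suc n) z < 1"
    using step.hyps(1) avoidance_bounds[of i n]
    by (auto intro!: step_less_one[of _ _ j])
  then show ?case ..
qed

text \<open>
  Adding a large multiple of the truncated expected return time
  \<open>\<Sum>n<m. avoidance i n\<close> to a Lyapunov function with negative drift outside a finite set
  makes the drift negative everywhere for the chain killed at \<open>i\<close>.
\<close>

lemma positive_recurrentI:
  assumes chain: "\<And>z. ctmc_from (P z) q z X"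
    and irreducible: "\<And>z i. (z, i) \<in> {(a, b). 0 < q a b}\<^sup>+"
    and V_nonneg: "\<And>z. 0 \<le> V z"
    and "finite F"
    and drift: "\<And>z. z \<notin> F \<Longrightarrow> generator V z \<le> -1"
    and bounded: "\<And>z. generator V z \<le> c"
  shows "positive_recurrent P X"
  unfolding positive_recurrent_def
proof
  fix i
  have "\<exists>n. \<forall>z\<in>F. avoidance i n z < 1"
    using \<open>finite F\<close>
  proof (induction F)
    case (insert z F)
    then obtain m n where "\<forall>z\<in>F. avoidance i m z < 1" "avoidance i n z < 1"
      using avoidance_less_one[OF irreducible] by blast
    then show ?case
      by (intro exI[of _ "max m n"])
        (auto intro: le_less_trans[OF avoidance_antimono[OF max.cobounded1]]
          le_less_trans[OF avoidance_antimono[OF max.cobounded2]])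
  qed simp
  then obtain m where m: "\<And>z. z \<in> F \<Longrightarrow> avoidance i m z < 1" by blast
  obtain \<delta> where \<delta>: "0 < \<delta>" "\<And>z. z \<in> F \<Longrightarrow> \<delta> \<le> 1 - avoidance i m z"
  proof
    let ?\<delta> = "Min (insert 1 ((\<lambda>z. 1 - avoidance i m z) ` F))"
    show "0 < ?\<delta>" using \<open>finite F\<close> m by (subst Min_gr_iff) auto
    show "?\<delta> \<le> 1 - avoidance i m z" if "z \<in> F" for z
      using \<open>finite F\<close> that by (intro Min_le) auto
  qed
  have "0 < hi" by (rule exit_rate_bounds(4))
  define T where "T z = (\<Sum>n<m. avoidance i n z)" for z
  \<comment> \<open>A drift of -1 per unit of time is at most \<open>- 1 / hi\<close> per jump,
    hence the factor \<open>hi\<close> in \<open>U\<close>. On \<open>F\<close> the drift of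
    \<open>hi * V\<close> may reach \<open>hi * \<bar>c\<bar> / lo\<close> per jump;
    \<open>b\<close> exceeds this by 1, and \<open>K * \<delta> = b\<close> compensates it.\<close>
  define b where "b = 1 + hi * \<bar>c\<bar> / lo"
  define K where "K = b / \<delta>"
  define U where "U z = hi * V z + K * T z" for z
  have "1 \<le> b" using \<open>0 < hi\<close> lo_pos by (simp add: b_def)
  have "0 \<le> K" using \<open>1 \<le> b\<close> \<delta> by (simp add: K_def)
  have T_nonneg: "0 \<le> T z" for z by (simp add: T_def sum_nonneg avoidance_bounds)
  have U_nonneg: "0 \<le> U z" for z
    using \<open>0 < hi\<close> \<open>0 \<le> K\<close> T_nonneg[of z] V_nonneg[of z] by (simp add: U_def)
  \<comment> \<open>The killed operator turns \<open>avoidance i n\<close> into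
    \<open>avoidance i (Suc n)\<close>, so the sum telescopes: the term 1 at index 0 is lost, the
    term at index \<open>m\<close> is gained.\<close>
  have T_step: "step (\<lambda>j. if j = i then 0 else T j) z = T z - (1 - avoidance i m z)" for z
  proof -
    have "(\<lambda>j. if j = i then 0 else T j) = (\<lambda>j. \<Sum>n<m. if j = i then 0 else avoidance i n j)"
      by (auto simp: T_def)
    then have "step (\<lambda>j. if j = i then 0 else T j) z = (\<Sum>n<m. avoidance i (Suc n) z)"
      by (simp add: step_sum)
    also have "\<dots> = T z - (1 - avoidance i m z)"
      using sum.lessThan_Suc_shift[of "\<lambda>n. avoidance i n z" m]
      unfolding T_def by (simp del: avoidance.simps(2))
    finally show ?thesis .
  qed
  have V_step: "hi * step V z \<le> hi * V z + (if z \<in> F then b else 0) - 1" for z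
  proof -
    have r: "lo \<le> exit_rate q z" "exit_rate q z \<le> hi" "0 < exit_rate q z"
      by (rule exit_rate_bounds)+
    have eq: "hi * step V z = hi * V z + hi * generator V z / exit_rate q z"
      by (simp add: step_eq_generator algebra_simps)
    show ?thesis
    proof (cases "z \<in> F")
      case True
      have "hi * generator V z / exit_rate q z \<le> hi * \<bar>c\<bar> / exit_rate q z"
        using bounded[of z] r \<open>0 < hi\<close> by (intro divide_right_mono mult_left_mono) auto
      also have "\<dots> \<le> hi * \<bar>c\<bar> / lo"
        using r lo_pos \<open>0 < hi\<close> by (intro divide_left_mono) auto
      finally show ?thesis using True eq by (simp add: b_def)
    next
      case False
      have "hi * generator V z / exit_rate q z \<le> hi * (-1) / exit_rate q z"
        using drift[OF False] r \<open>0 < hi\<close> by (intro divide_right_mono mult_left_mono) auto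
      also have "\<dots> \<le> -1" using r by (simp add: field_simps)
      finally show ?thesis using False eq by simp
    qed
  qed
  have U_step: "step (\<lambda>j. if j = i then 0 else U j) z \<le> U z - 1" for z
  proof -
    have "step (\<lambda>j. if j = i then 0 else U j) z \<le>
        step (\<lambda>j. hi * V j + K * (if j = i then 0 else T j)) z"
      using \<open>0 < hi\<close> V_nonneg by (intro step_mono) (auto simp: U_def)
    also have "\<dots> = hi * step V z + K * (T z - (1 - avoidance i m z))"
      by (simp add: step_add step_cmult T_step)
    also have "\<dots> \<le> U z - 1 + ((if z \<in> F then b else 0) - K * (1 - avoidance i m z))"
      using V_step[of z] by (simp add: U_def algebra_simps)
    also have "(if z \<in> F then b else 0) - K * (1 - avoidance i m z) \<le> 0"
    proof (cases "z \<in> F")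
      case True
      have "b = K * \<delta>" using \<delta> by (simp add: K_def)
      also have "\<dots> \<le> K * (1 - avoidance i m z)"
        using \<delta>(2)[OF True] \<open>0 \<le> K\<close> by (rule mult_left_mono)
      finally show ?thesis using True by simp
    qed (use \<open>0 \<le> K\<close> avoidance_bounds[of i m z] in simp)
    finally show ?thesis by simp
  qed
  obtain Y H where "jump_chain q N lo hi (P i) i Y H"
    and X: "AE \<omega> in P i. \<forall>n t. (\<Sum>k<n. H k \<omega>) \<le> t \<and> t < (\<Sum>k<Suc n. H k \<omega>) \<longrightarrow> X t \<omega> = Y n \<omega>"
    using ctmc_fromE[OF chain] .
  then interpret jump_chain q N lo hi "P i" i Y H by simp
  show "(\<integral>\<^sup>+ \<omega>. return_time X i \<omega> \<partial>P i) < \<infinity>"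
    by (rule return_time_integrable[OF X U_nonneg U_step])
qed

end

section \<open>The modified Jackson network\<close>

text \<open>On the boundary, truncated subtraction makes some of these targets coincide with others
  or with the state itself; the service rates that belong to them are 0 there.\<close>

fun jackson_targets :: "nat \<times> nat \<Rightarrow> (nat \<times> nat) set" where
  "jackson_targets (x, y) = {(x + 1, y), (x, y + 1), (x - 1, y), (x - 1, y + 1), (x, y - 1), (x + 1, y - 1)}"

locale modified_jackson =
  fixes a1 a2 m1 m2 m1s r12 r21 l1 l2 :: real
  assumes a1: "0 \<le> a1" and a2: "0 \<le> a2" and m1: "0 < m1" and m2: "0 < m2" and m1s: "m1 \<le> m1s"
    and r12: "0 \<le> r12" "r12 \<le> 1" and r21: "0 \<le> r21" "r21 \<le> 1" and r12_r21: "r12 * r21 < 1"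
    and l1_eq: "l1 = a1 + l2 * r21" and l2_eq: "l2 = a2 + l1 * r12" and l1: "0 < l1" and l2: "0 < l2"
begin

abbreviation "rate \<equiv> modified_jackson_rate a1 a2 m1 m1s m2 r12 r21"

definition service1 :: "nat \<Rightarrow> nat \<Rightarrow> real" where
  "service1 x y = (if x = 0 then 0 else if y = 0 then m1s else m1)"

definition service2 :: "nat \<Rightarrow> real" where
  "service2 y = (if y = 0 then 0 else m2)"

lemma services_nonneg: "0 \<le> service1 x y" "0 \<le> service2 y"
  using m1 m2 m1s by (auto simp: service1_def service2_def)

lemma service_bounds: "service1 x y \<le> m1s" "service2 y \<le> m2"
  using m1 m2 m1s by (auto simp: service1_def service2_def)

text \<open>Service rates that vanish at an empty node absorb the case distinctions, so interior and
  boundary share one formula.\<close>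

lemma rate_eq: "rate (x, y) z =
     (if z = (x + 1, y) then a1 else 0) +
     (if z = (x, y + 1) then a2 else 0) +
     (if z = (x - 1, y) then service1 x y * (1 - r12) else 0) +
     (if z = (x - 1, y + 1) then service1 x y * r12 else 0) +
     (if z = (x, y - 1) then service2 y * (1 - r21) else 0) +
     (if z = (x + 1, y - 1) then service2 y * r21 else 0)"
  by (cases x; cases y) (simp_all add: modified_jackson_rate_def service1_def service2_def)

lemma sum_rate:
  "(\<Sum>z\<in>jackson_targets (x, y). rate (x, y) z * u z) =
     a1 * u (x + 1, y) + a2 * u (x, y + 1) +
     service1 x y * ((1 - r12) * u (x - 1, y) + r12 * u (x - 1, y + 1)) +
     service2 y * ((1 - r21) * u (x, y - 1) + r21 * u (x + 1, y - 1))"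
proof -
  have single: "(\<Sum>z\<in>jackson_targets (x, y). (if z = t then c else 0) * u z) = c * u t"
    if "t \<in> jackson_targets (x, y)" for t c
  proof -
    have "(\<Sum>z\<in>jackson_targets (x, y). (if z = t then c else 0) * u z) =
        (\<Sum>z\<in>jackson_targets (x, y). if z = t then c * u z else 0)"
      by (intro sum.cong) auto
    then show ?thesis using that by simp
  qed
  have t: "(x + 1, y) \<in> jackson_targets (x, y)" "(x, y + 1) \<in> jackson_targets (x, y)"
    "(x - 1, y) \<in> jackson_targets (x, y)" "(x - 1, y + 1) \<in> jackson_targets (x, y)"
    "(x, y - 1) \<in> jackson_targets (x, y)" "(x + 1, y - 1) \<in> jackson_targets (x, y)"
    by auto
  show ?thesis
    unfolding rate_eq distrib_right sum.distrib t[THEN single] by (simp add: algebra_simps)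
qed

text \<open>Without exogenous arrivals the traffic equations are homogeneous with determinant
  \<open>1 - r12 * r21 > 0\<close>, which forces \<open>l1 = 0\<close>. The total arrival rate then
  serves as \<open>lo\<close>.\<close>

lemma arrivals_pos: "0 < a1 + a2"
proof (rule ccontr)
  assume "\<not> 0 < a1 + a2"
  then have "a1 = 0" "a2 = 0" using a1 a2 by auto
  then have "l1 * (1 - r12 * r21) = 0"
    using l1_eq l2_eq by (simp add: algebra_simps)
  then show False using l1 r12_r21 by simp
qed

lemma sum_rate_one: "(\<Sum>z\<in>jackson_targets (x, y). rate (x, y) z) = a1 + a2 + service1 x y + service2 y"
  using sum_rate[of x y "\<lambda>_. 1"] by simp

sublocale finite_range_rates rate jackson_targets "a1 + a2" "a1 + a2 + m1s + m2"
proof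
  fix z j :: "nat \<times> nat"
  obtain x y where z: "z = (x, y)" by (cases z)
  show "finite (jackson_targets z)" by (simp add: z)
  show "0 \<le> rate z j"
    unfolding z rate_eq using a1 a2 r12 r21 services_nonneg by (intro add_nonneg_nonneg) auto
  show "rate z j = 0" if "j \<notin> jackson_targets z"
    using that unfolding z rate_eq by auto
  show "rate z z = 0"
    by (auto simp: z modified_jackson_rate_def)
  show "a1 + a2 \<le> (\<Sum>j\<in>jackson_targets z. rate z j)" "(\<Sum>j\<in>jackson_targets z. rate z j) \<le> a1 + a2 + m1s + m2"
    unfolding z sum_rate_one using services_nonneg(1)[of x y] services_nonneg(2)[of y] service_bounds(1)[of x y] service_bounds(2)[of y]
    by auto
qed (rule arrivals_pos)

lemma generator_eq:
  "generator u (x, y) =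
     a1 * (u (x + 1, y) - u (x, y)) + a2 * (u (x, y + 1) - u (x, y)) +
     service1 x y * ((1 - r12) * (u (x - 1, y) - u (x, y)) + r12 * (u (x - 1, y + 1) - u (x, y))) +
     service2 y * ((1 - r21) * (u (x, y - 1) - u (x, y)) + r21 * (u (x + 1, y - 1) - u (x, y)))"
  unfolding generator_def by (rule sum_rate)

section \<open>Linear functions and transience of the network\<close>

definition drift1 :: "nat \<Rightarrow> nat \<Rightarrow> real" where
  "drift1 x y = a1 - service1 x y + service2 y * r21"

definition drift2 :: "nat \<Rightarrow> nat \<Rightarrow> real" where
  "drift2 x y = a2 + service1 x y * r12 - service2 y"

abbreviation weighted :: "real \<Rightarrow> real \<Rightarrow> nat \<times> nat \<Rightarrow> real" where
  "weighted \<alpha> \<beta> \<equiv> \<lambda>(x, y). \<alpha> * real x + \<beta> * real y"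

lemma generator_weighted: "generator (weighted \<alpha> \<beta>) (x, y) = \<alpha> * drift1 x y + \<beta> * drift2 x y"
proof -
  let ?u = "weighted \<alpha> \<beta>"
  have 1: "service1 x y * ((1 - r12) * (?u (x - 1, y) - ?u (x, y)) + r12 * (?u (x - 1, y + 1) - ?u (x, y)))
      = service1 x y * (r12 * \<beta> - \<alpha>)"
    by (cases x) (simp add: service1_def, simp add: algebra_simps)
  have 2: "service2 y * ((1 - r21) * (?u (x, y - 1) - ?u (x, y)) + r21 * (?u (x + 1, y - 1) - ?u (x, y)))
      = service2 y * (r21 * \<alpha> - \<beta>)"
    by (cases y) (simp add: service2_def, simp add: algebra_simps)
  show ?thesis
    unfolding generator_eq 1 2 drift1_def drift2_def by (simp add: algebra_simps)
qed

lemma weighted_jumps: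
  assumes "0 < rate z j"
  shows "\<bar>weighted \<alpha> \<beta> j - weighted \<alpha> \<beta> z\<bar> \<le> \<bar>\<alpha>\<bar> + \<bar>\<beta>\<bar>"
proof -
  obtain x y where z: "z = (x, y)" by (cases z)
  obtain x' y' where j: "j = (x', y')" by (cases j)
  have "j \<in> jackson_targets z" by (rule ccontr) (use assms q_outside[of j z] in simp)
  then have "\<bar>real x' - real x\<bar> \<le> 1" "\<bar>real y' - real y\<bar> \<le> 1"
    by (auto simp: z j of_nat_diff)
  then have "\<bar>\<alpha>\<bar> * \<bar>real x' - real x\<bar> \<le> \<bar>\<alpha>\<bar>" "\<bar>\<beta>\<bar> * \<bar>real y' - real y\<bar> \<le> \<bar>\<beta>\<bar>"
    by (auto intro: mult_left_le)
  moreover have "weighted \<alpha> \<beta> j - weighted \<alpha> \<beta> z = \<alpha> * (real x' - real x) + \<beta> * (real y' - real y)"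
    by (simp add: z j algebra_simps)
  ultimately show ?thesis by (simp add: abs_mult[symmetric])
qed

lemma transient_weighted:
  assumes "\<And>z. ctmc_from (P z) rate z W"
    and "0 < \<epsilon>" "\<And>x y. \<epsilon> \<le> \<alpha> * drift1 x y + \<beta> * drift2 x y"
  shows "transient P W"
proof (rule transientI[where f = "weighted \<alpha> \<beta>" and B = "\<bar>\<alpha>\<bar> + \<bar>\<beta>\<bar>" and \<epsilon> = \<epsilon>])
  show "\<epsilon> \<le> generator (weighted \<alpha> \<beta>) z" for z
    by (cases z) (simp only: generator_weighted assms(3))
qed (use assms weighted_jumps in auto)

text \<open>The traffic equations eliminate the exogenous rates: the drift vector is the matrix with
  rows \<open>(1, - r21)\<close> and \<open>(- r12, 1)\<close> applied to the excesses
  \<open>l1 - service1 x y\<close> and \<open>l2 - service2 y\<close>.\<close>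

lemma drift1_eq: "drift1 x y = l1 - service1 x y - r21 * (l2 - service2 y)"
  using l1_eq by (simp add: drift1_def algebra_simps)

lemma drift2_eq: "drift2 x y = l2 - service2 y - r12 * (l1 - service1 x y)"
  using l2_eq by (simp add: drift2_def algebra_simps)

text \<open>The weights \<open>(r12, 1)\<close> here and \<open>(1, r21)\<close> for node 1 are the
  rows of the adjugate of that matrix, so each combination isolates one excess, up to the
  determinant.\<close>

lemma drift_node2: "r12 * drift1 x y + drift2 x y = (1 - r12 * r21) * (l2 - service2 y)"
  unfolding drift1_eq drift2_eq by (simp add: algebra_simps)

lemma drift_node1: "drift1 x y + r21 * drift2 x y = (1 - r12 * r21) * (l1 - service1 x y)"
  unfolding drift1_eq drift2_eq by (simp add: algebra_simps)

definition slope :: real where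
  "slope = (m1s - m1) / m2"

lemma slope_nonneg: "0 \<le> slope"
  using m1s m2 by (simp add: slope_def)

text \<open>
  The value \<open>slope\<close> is chosen so that the drift of \<open>x + r21 * y + slope * (r12 * x + y)\<close> is
  the same on the horizontal boundary and in the interior.
\<close>

lemma slope_drift:
  "l1 - service1 x y + slope * (l2 - service2 y) =
    l1 - (l2 / m2 * m1 + (1 - l2 / m2) * m1s) + (if 0 < x then 0 else if 0 < y then m1 else m1s)"
  using m2 by (auto simp: service1_def service2_def slope_def field_simps)

text \<open>Missing service enters with a positive sign: an empty node 2 only raises the first drift
  and an idle node 1 only raises the second, so both have constant lower bounds.\<close>

lemma transient_if_overloaded:
  assumes chain: "\<And>z. ctmc_from (P z) rate z W"
    and over: "m2 < l2 \<or> l2 / m2 * m1 + (1 - l2 / m2) * m1s < l1"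
  shows "transient P W"
proof -
  let ?\<kappa> = "1 - r12 * r21"
  have \<kappa>: "0 < ?\<kappa>" using r12_r21 by simp
  from over show ?thesis
  proof
    assume "m2 < l2"
    have "?\<kappa> * (l2 - m2) \<le> r12 * drift1 x y + 1 * drift2 x y" for x y
      using service_bounds(2)[of y] \<kappa> drift_node2[of x y] by (simp add: mult_left_mono)
    moreover have "0 < ?\<kappa> * (l2 - m2)" using \<kappa> \<open>m2 < l2\<close> by simp
    ultimately show ?thesis by (intro transient_weighted[OF chain])
  next
    let ?\<delta> = "l1 - (l2 / m2 * m1 + (1 - l2 / m2) * m1s)"
    assume less: "l2 / m2 * m1 + (1 - l2 / m2) * m1s < l1"
    have "?\<kappa> * ?\<delta> \<le> (1 + slope * r12) * drift1 x y + (r21 + slope) * drift2 x y" for x y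
    proof -
      have "?\<kappa> * ?\<delta> \<le> ?\<kappa> * (l1 - service1 x y + slope * (l2 - service2 y))"
        unfolding slope_drift using \<kappa> m1 m1s by (intro mult_left_mono) auto
      also have "\<dots> = (drift1 x y + r21 * drift2 x y) + slope * (r12 * drift1 x y + drift2 x y)"
        unfolding drift_node1 drift_node2 by (simp add: algebra_simps)
      finally show ?thesis by (simp add: algebra_simps)
    qed
    moreover have "0 < ?\<kappa> * ?\<delta>" using \<kappa> less by simp
    ultimately show ?thesis by (intro transient_weighted[OF chain])
  qed
qed

section \<open>Irreducibility of the network\<close>

abbreviation "edges \<equiv> {(z, z'). 0 < rate z z'}"

lemma edge_arrival1: "0 < a1 \<Longrightarrow> ((x, y), (x + 1, y)) \<in> edges"
  using a2 r12 r21 services_nonneg by (auto simp: rate_eq intro!: add_pos_nonneg)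

lemma edge_arrival2: "0 < a2 \<Longrightarrow> ((x, y), (x, y + 1)) \<in> edges"
  using a1 r12 r21 services_nonneg by (auto simp: rate_eq intro!: add_pos_nonneg)

lemma service1_pos: "0 < service1 (Suc x) y"
  using m1 m1s by (auto simp: service1_def)

lemma edge_departure1: "r12 < 1 \<Longrightarrow> ((Suc x, y), (x, y)) \<in> edges"
  using service1_pos[of x y] by (simp add: rate_eq)

lemma edge_transfer1: "0 < r12 \<Longrightarrow> ((Suc x, y), (x, Suc y)) \<in> edges"
  using service1_pos[of x y] by (simp add: rate_eq)

lemma edge_departure2: "r21 < 1 \<Longrightarrow> ((x, Suc y), (x, y)) \<in> edges"
  using m2 by (simp add: rate_eq service2_def)

lemma edge_transfer2: "0 < r21 \<Longrightarrow> ((x, Suc y), (Suc x, y)) \<in> edges"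
  using m2 by (simp add: rate_eq service2_def)

text \<open>If \<open>a1 = 0\<close>, the flow \<open>l1 > 0\<close> can only come from node 2, so
  \<open>r21 > 0\<close>, and all arrivals occur at node 2: a customer arrives there and is routed
  to node 1.\<close>

lemma reach_up1: "((x, y), (Suc x, y)) \<in> edges\<^sup>+"
proof (cases "0 < a1")
  case True
  then show ?thesis using edge_arrival1[of x y] by auto
next
  case False
  then have "a1 = 0" using a1 by simp
  then have "0 < a2" "0 < r21"
    using arrivals_pos l1_eq l1 l2 r21 by (auto simp: zero_less_mult_iff)
  then show ?thesis
    using edge_arrival2[of x y] edge_transfer2[of x y] by (auto intro: trancl_into_trancl)
qed

lemma reach_up2: "((x, y), (x, Suc y)) \<in> edges\<^sup>+"
proof (cases "0 < a2")
  case True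
  then show ?thesis using edge_arrival2[of x y] by auto
next
  case False
  then have "a2 = 0" using a2 by simp
  then have "0 < a1" "0 < r12"
    using arrivals_pos l2_eq l1 l2 r12 by (auto simp: zero_less_mult_iff)
  then show ?thesis
    using edge_arrival1[of x y] edge_transfer1[of x y] by (auto intro: trancl_into_trancl)
qed

lemma reach_from_origin: "((0, 0), (x, y)) \<in> edges\<^sup>*"
proof -
  have "((0, 0), (x, 0)) \<in> edges\<^sup>*"
    by (induction x) (auto intro: rtrancl_trans[OF _ trancl_into_rtrancl[OF reach_up1]])
  moreover have "((x, 0), (x, y)) \<in> edges\<^sup>*"
    by (induction y) (auto intro: rtrancl_trans[OF _ trancl_into_rtrancl[OF reach_up2]])
  ultimately show ?thesis by (rule rtrancl_trans)
qed

text \<open>Since \<open>r12 * r21 < 1\<close>, customers can leave the network directly from at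
  least one node. That node can be emptied; a customer of the other node either leaves too or is
  routed to the first one and leaves from there.\<close>

lemma reach_origin: "((x, y), (0, 0)) \<in> edges\<^sup>*"
proof (cases "r12 < 1")
  case True
  have down1: "((x, y), (0, y)) \<in> edges\<^sup>*" for x y
    by (induction x) (use edge_departure1[OF True] in \<open>auto intro: converse_rtrancl_into_rtrancl\<close>)
  have "((0, Suc y), (0, y)) \<in> edges\<^sup>*" for y
  proof (cases "r21 < 1")
    case True
    then show ?thesis using edge_departure2 by blast
  next
    case False
    then have "((0, Suc y), (Suc 0, y)) \<in> edges" by (intro edge_transfer2) simp
    then show ?thesis using down1 by (rule converse_rtrancl_into_rtrancl)
  qed
  then have "((0, y), (0, 0)) \<in> edges\<^sup>*"
    by (induction y) (auto intro: rtrancl_trans)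
  with down1 show ?thesis by (rule rtrancl_trans)
next
  case False
  then have "r12 = 1" using r12 by simp
  then have "r21 < 1" using r12_r21 by simp
  have down2: "((x, y), (x, 0)) \<in> edges\<^sup>*" for x y
    by (induction y) (use edge_departure2[OF \<open>r21 < 1\<close>] in \<open>auto intro: converse_rtrancl_into_rtrancl\<close>)
  have "((Suc x, 0), (x, 0)) \<in> edges\<^sup>*" for x
  proof -
    have "((Suc x, 0), (x, Suc 0)) \<in> edges" by (intro edge_transfer1) (simp add: \<open>r12 = 1\<close>)
    then show ?thesis using down2 by (rule converse_rtrancl_into_rtrancl)
  qed
  then have "((x, 0), (0, 0)) \<in> edges\<^sup>*"
    by (induction x) (auto intro: rtrancl_trans)
  with down2 show ?thesis by (rule rtrancl_trans)
qed

lemma irreducible: "(z, z') \<in> edges\<^sup>+"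
proof -
  obtain x y x' y' where z: "z = (x, y)" "z' = (x', y')" by (cases z, cases z')
  \<comment> \<open>This initial step up makes the path nonempty, also when
    \<open>z = z'\<close>.\<close>
  have "((x, y), (Suc x, y)) \<in> edges\<^sup>+" by (rule reach_up1)
  moreover have "((Suc x, y), (x', y')) \<in> edges\<^sup>*"
    using reach_origin reach_from_origin by (rule rtrancl_trans)
  ultimately show ?thesis unfolding z by (rule trancl_rtrancl_trancl)
qed

section \<open>Quadratic form and positive recurrence of the network\<close>

definition quadratic :: "real \<Rightarrow> real \<Rightarrow> real \<Rightarrow> nat \<times> nat \<Rightarrow> real" where
  "quadratic A B C = (\<lambda>(x, y). A * (real x)\<^sup>2 + 2 * B * real x * real y + C * (real y)\<^sup>2)"

text \<open>A jump changes each coordinate by at most 1, so the second-order part of an increment is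
  at most \<open>A + 2 * B + C\<close>; this is multiplied by a bound on the total rate. The
  first-order parts add up to the drifts.\<close>

lemma generator_quadratic:
  assumes "0 \<le> A" "0 \<le> B" "0 \<le> C"
  shows "generator (quadratic A B C) (x, y) \<le>
    2 * real x * (A * drift1 x y + B * drift2 x y) + 2 * real y * (B * drift1 x y + C * drift2 x y)
      + (a1 + a2 + m1s + m2) * (A + 2 * B + C)"
proof -
  let ?K = "A + 2 * B + C"
  let ?lin = "\<lambda>d e. 2 * real x * (A * d + B * e) + 2 * real y * (B * d + C * e) + ?K"
  have inc: "quadratic A B C (x', y') - quadratic A B C (x, y) \<le> ?lin d e"
    if "real x' = real x + d" "real y' = real y + e" "d \<in> {-1, 0, 1}" "e \<in> {-1, 0, 1}" for x' y' d e
  proof -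
    have "quadratic A B C (x', y') - quadratic A B C (x, y) =
        2 * real x * (A * d + B * e) + 2 * real y * (B * d + C * e) + (A * d\<^sup>2 + 2 * B * (d * e) + C * e\<^sup>2)"
      by (simp add: quadratic_def that(1,2) algebra_simps power2_eq_square)
    also have "A * d\<^sup>2 + 2 * B * (d * e) + C * e\<^sup>2 \<le> ?K"
      using that(3,4) assms by auto
    finally show ?thesis by simp
  qed
  let ?\<Delta> = "\<lambda>x' y'. quadratic A B C (x', y') - quadratic A B C (x, y)"
  have s1: "service1 x y * ((1 - r12) * ?\<Delta> (x - 1) y + r12 * ?\<Delta> (x - 1) (y + 1)) \<le>
      service1 x y * ((1 - r12) * ?lin (-1) 0 + r12 * ?lin (-1) 1)"
  \<comment> \<open>At \<open>x = 0\<close> truncated subtraction invalidates the increment formula,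
    but the service rate is 0 there.\<close>
  proof (cases "x = 0")
    case False
    then show ?thesis
      using r12 services_nonneg by (intro mult_left_mono add_mono inc) (auto simp: of_nat_diff)
  qed (simp add: service1_def)
  have s2: "service2 y * ((1 - r21) * ?\<Delta> x (y - 1) + r21 * ?\<Delta> (x + 1) (y - 1)) \<le>
      service2 y * ((1 - r21) * ?lin 0 (-1) + r21 * ?lin 1 (-1))"
  proof (cases "y = 0")
    case False
    then show ?thesis
      using r21 services_nonneg by (intro mult_left_mono add_mono inc) (auto simp: of_nat_diff)
  qed (simp add: service2_def)
  have "generator (quadratic A B C) (x, y) \<le> a1 * ?lin 1 0 + a2 * ?lin 0 1 +
      service1 x y * ((1 - r12) * ?lin (-1) 0 + r12 * ?lin (-1) 1) +
      service2 y * ((1 - r21) * ?lin 0 (-1) + r21 * ?lin 1 (-1))"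
    unfolding generator_eq using a1 a2 by (intro add_mono s1 s2 mult_left_mono inc) auto
  also have "\<dots> = 2 * real x * (A * drift1 x y + B * drift2 x y) + 2 * real y * (B * drift1 x y + C * drift2 x y)
      + (a1 + a2 + service1 x y + service2 y) * ?K"
    by (simp add: drift1_def drift2_def algebra_simps)
  also have "(a1 + a2 + service1 x y + service2 y) * ?K \<le> (a1 + a2 + m1s + m2) * ?K"
    using assms service_bounds by (intro mult_right_mono add_mono) auto
  finally show ?thesis by simp
qed

text \<open>
  Small perturbations of the two linear functions above have negative drift for \<open>0 < x\<close>
  and for \<open>0 < y\<close>, respectively. The quadratic function combines them so that its drift
  is \<open>2 * \<gamma> * x\<close> times the first drift plus \<open>2 * \<beta> * y\<close> times the second one, up to a constant.
\<close>

lemma positive_recurrent_if_stable: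
  assumes chain: "\<And>z. ctmc_from (P z) rate z W"
    and stable2: "l2 < m2" and stable1: "l1 < l2 / m2 * m1 + (1 - l2 / m2) * m1s"
  shows "positive_recurrent P W"
proof -
  let ?\<kappa> = "1 - r12 * r21"
  have \<kappa>: "0 < ?\<kappa>" using r12_r21 by simp
  define \<delta>1 where "\<delta>1 = (l2 / m2 * m1 + (1 - l2 / m2) * m1s) - l1"
  define \<delta>2 where "\<delta>2 = m2 - l2"
  have \<delta>: "0 < \<delta>1" "0 < \<delta>2" using stable1 stable2 by (auto simp: \<delta>1_def \<delta>2_def)
  \<comment> \<open>The perturbations add at most \<open>\<epsilon> * l2\<close> for
    \<open>0 < x\<close> and at most \<open>\<epsilon> * l1\<close> for \<open>0 < y\<close>; this
    is allowed to use up half of each negative drift.\<close>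
  define \<epsilon> where "\<epsilon> = min (\<delta>1 / (2 * l2)) (\<delta>2 / (2 * l1))"
  have \<epsilon>: "0 < \<epsilon>" "\<epsilon> * l2 \<le> \<delta>1 / 2" "\<epsilon> * l1 \<le> \<delta>2 / 2"
  proof -
    show "0 < \<epsilon>" using \<delta> l1 l2 by (simp add: \<epsilon>_def)
    have "\<epsilon> \<le> \<delta>1 / (2 * l2)" "\<epsilon> \<le> \<delta>2 / (2 * l1)" by (auto simp: \<epsilon>_def)
    then show "\<epsilon> * l2 \<le> \<delta>1 / 2" "\<epsilon> * l1 \<le> \<delta>2 / 2"
      using l1 l2 by (auto simp: field_simps)
  qed
  \<comment> \<open>\<open>\<alpha>\<close> and \<open>\<beta>\<close> are the coefficients of the
    first function plus \<open>\<epsilon>\<close> times the second, \<open>\<gamma>\<close> and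
    \<open>\<eta>\<close> those of the second plus \<open>\<epsilon>\<close> times the first. With
    \<open>\<epsilon> = 0\<close>, \<open>\<gamma>\<close> would vanish for \<open>r12 = 0\<close>,
    and \<open>\<beta>\<close> for \<open>r21 = 0\<close> and \<open>m1s = m1\<close>.\<close>
  define \<alpha> where "\<alpha> = 1 + slope * r12 + \<epsilon> * r12"
  define \<beta> where "\<beta> = r21 + slope + \<epsilon>"
  define \<gamma> where "\<gamma> = r12 + \<epsilon> * (1 + slope * r12)"
  define \<eta> where "\<eta> = 1 + \<epsilon> * (r21 + slope)"
  have pos: "0 < \<alpha>" "0 < \<beta>" "0 < \<gamma>" "0 < \<eta>"
  proof -
    have "0 \<le> slope * r12" "0 \<le> \<epsilon> * r12" "0 \<le> \<epsilon> * (r21 + slope)"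
      using \<epsilon>(1) slope_nonneg r12 r21 by auto
    moreover from this have "0 < \<epsilon> * (1 + slope * r12)" using \<epsilon>(1) by simp
    ultimately show "0 < \<alpha>" "0 < \<beta>" "0 < \<gamma>" "0 < \<eta>"
      using \<epsilon>(1) slope_nonneg r12 r21 unfolding \<alpha>_def \<beta>_def \<gamma>_def \<eta>_def by linarith+
  qed
  let ?h = "\<lambda>x y. l1 - service1 x y + slope * (l2 - service2 y)"
  have lin1: "\<alpha> * drift1 x y + \<beta> * drift2 x y = ?\<kappa> * (?h x y + \<epsilon> * (l2 - service2 y))" for x y
  proof -
    have "\<alpha> * drift1 x y + \<beta> * drift2 x y =
        (drift1 x y + r21 * drift2 x y) + (slope + \<epsilon>) * (r12 * drift1 x y + drift2 x y)"
      by (simp add: \<alpha>_def \<beta>_def algebra_simps)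
    also have "\<dots> = ?\<kappa> * (?h x y + \<epsilon> * (l2 - service2 y))"
      unfolding drift_node1 drift_node2 by (simp add: algebra_simps)
    finally show ?thesis .
  qed
  have lin2: "\<gamma> * drift1 x y + \<eta> * drift2 x y = ?\<kappa> * (l2 - service2 y + \<epsilon> * ?h x y)" for x y
  proof -
    have "\<gamma> * drift1 x y + \<eta> * drift2 x y =
        \<epsilon> * (drift1 x y + r21 * drift2 x y) + (1 + \<epsilon> * slope) * (r12 * drift1 x y + drift2 x y)"
      by (simp add: \<gamma>_def \<eta>_def algebra_simps)
    also have "\<dots> = ?\<kappa> * (l2 - service2 y + \<epsilon> * ?h x y)"
      unfolding drift_node1 drift_node2 by (simp add: algebra_simps)
    finally show ?thesis .
  qed
  \<comment> \<open>The factor \<open>real x\<close> removes the states with \<open>x = 0\<close>,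
    where the first drift may be positive.\<close>
  have drift_x: "real x * (\<alpha> * drift1 x y + \<beta> * drift2 x y) \<le> - (?\<kappa> * \<delta>1 / 2) * real x" for x y
  proof (cases "x = 0")
    case False
    have "?h x y = - \<delta>1" unfolding slope_drift using False by (simp add: \<delta>1_def)
    moreover have "\<epsilon> * (l2 - service2 y) \<le> \<epsilon> * l2"
      using \<epsilon>(1) services_nonneg by (intro mult_left_mono) auto
    ultimately have "?h x y + \<epsilon> * (l2 - service2 y) \<le> - (\<delta>1 / 2)" using \<epsilon>(2) by linarith
    then have "\<alpha> * drift1 x y + \<beta> * drift2 x y \<le> ?\<kappa> * (- (\<delta>1 / 2))"
      unfolding lin1 using \<kappa> by (intro mult_left_mono) auto
    then have "real x * (\<alpha> * drift1 x y + \<beta> * drift2 x y) \<le> real x * (?\<kappa> * (- (\<delta>1 / 2)))"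
      by (rule mult_left_mono) simp
    then show ?thesis by (simp add: algebra_simps)
  qed simp
  have drift_y: "real y * (\<gamma> * drift1 x y + \<eta> * drift2 x y) \<le> - (?\<kappa> * \<delta>2 / 2) * real y" for x y
  proof (cases "y = 0")
    case False
    then have s: "l2 - service2 y = - \<delta>2" by (simp add: service2_def \<delta>2_def)
    have "slope * (l2 - service2 y) \<le> 0"
      unfolding s using slope_nonneg \<delta> by (simp add: mult_nonneg_nonpos)
    then have "?h x y \<le> l1" using services_nonneg(1)[of x y] by linarith
    then have "\<epsilon> * ?h x y \<le> \<epsilon> * l1" using \<epsilon>(1) by (intro mult_left_mono) auto
    then have "l2 - service2 y + \<epsilon> * ?h x y \<le> - (\<delta>2 / 2)" using s \<epsilon>(3) by linarith
    then have "\<gamma> * drift1 x y + \<eta> * drift2 x y \<le> ?\<kappa> * (- (\<delta>2 / 2))"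
      unfolding lin2 using \<kappa> by (intro mult_left_mono) auto
    then have "real y * (\<gamma> * drift1 x y + \<eta> * drift2 x y) \<le> real y * (?\<kappa> * (- (\<delta>2 / 2)))"
      by (rule mult_left_mono) simp
    then show ?thesis by (simp add: algebra_simps)
  qed simp
  \<comment> \<open>Scaling \<open>(\<alpha>, \<beta>)\<close> by \<open>\<gamma>\<close> and
    \<open>(\<gamma>, \<eta>)\<close> by \<open>\<beta>\<close> produces the common mixed
    coefficient \<open>\<gamma> * \<beta>\<close>.\<close>
  define V where "V = quadratic (\<gamma> * \<alpha>) (\<gamma> * \<beta>) (\<beta> * \<eta>)"
  define c where "c = (a1 + a2 + m1s + m2) * (\<gamma> * \<alpha> + 2 * (\<gamma> * \<beta>) + \<beta> * \<eta>)"
  define \<rho>1 where "\<rho>1 = \<gamma> * (?\<kappa> * \<delta>1)"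
  define \<rho>2 where "\<rho>2 = \<beta> * (?\<kappa> * \<delta>2)"
  have \<rho>: "0 < \<rho>1" "0 < \<rho>2" using pos \<kappa> \<delta> by (auto simp: \<rho>1_def \<rho>2_def)
  have gen: "generator V (x, y) \<le> c - \<rho>1 * real x - \<rho>2 * real y" for x y
  proof -
    have "generator V (x, y) \<le> 2 * real x * (\<gamma> * \<alpha> * drift1 x y + \<gamma> * \<beta> * drift2 x y)
        + 2 * real y * (\<gamma> * \<beta> * drift1 x y + \<beta> * \<eta> * drift2 x y) + c"
      unfolding V_def c_def using pos by (intro generator_quadratic) (auto intro: less_imp_le)
    also have "\<dots> = 2 * \<gamma> * (real x * (\<alpha> * drift1 x y + \<beta> * drift2 x y))
        + 2 * \<beta> * (real y * (\<gamma> * drift1 x y + \<eta> * drift2 x y)) + c"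
      by (simp add: algebra_simps)
    also have "\<dots> \<le> 2 * \<gamma> * (- (?\<kappa> * \<delta>1 / 2) * real x) + 2 * \<beta> * (- (?\<kappa> * \<delta>2 / 2) * real y) + c"
      using pos by (intro add_mono mult_left_mono drift_x drift_y) (auto intro: less_imp_le)
    also have "\<dots> = c - \<rho>1 * real x - \<rho>2 * real y" by (simp add: \<rho>1_def \<rho>2_def field_simps)
    finally show ?thesis .
  qed
  obtain n1 n2 :: nat where n: "(c + 1) / \<rho>1 \<le> real n1" "(c + 1) / \<rho>2 \<le> real n2"
    using real_arch_simple by meson
  show ?thesis
  proof (rule positive_recurrentI[OF chain irreducible, where V = V and c = c and F = "{..n1} \<times> {..n2}"])
    show "0 \<le> V z" for z
      using pos by (cases z) (simp add: V_def quadratic_def)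
    show "generator V z \<le> c" for z
    proof (cases z)
      case (Pair x y)
      have "0 \<le> \<rho>1 * real x" "0 \<le> \<rho>2 * real y" using \<rho> by auto
      then show ?thesis using gen[of x y] unfolding Pair by linarith
    qed
    show "generator V z \<le> - 1" if "z \<notin> {..n1} \<times> {..n2}" for z
    proof (cases z)
      case (Pair x y)
      have nonneg: "0 \<le> \<rho>1 * real x" "0 \<le> \<rho>2 * real y" using \<rho> by auto
      have "n1 < x \<or> n2 < y" using that unfolding Pair by auto
      then have "c + 1 \<le> \<rho>1 * real x \<or> c + 1 \<le> \<rho>2 * real y"
      proof
        assume "n1 < x"
        then have "(c + 1) / \<rho>1 \<le> real x" using n by linarith
        then show ?thesis using \<rho> by (simp add: field_simps)
      next
        assume "n2 < y"
        then have "(c + 1) / \<rho>2 \<le> real y" using n by linarith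
        then show ?thesis using \<rho> by (simp add: field_simps)
      qed
      then show ?thesis using gen[of x y] nonneg unfolding Pair by linarith
    qed
  qed simp
qed

end

theorem proposition1:
  fixes lbar1 lbar2 l1 l2 m1 m2 m1s r12 r21 rho2 :: real
    and P :: "nat \<times> nat \<Rightarrow> 'w measure"
    and W :: "real \<Rightarrow> 'w \<Rightarrow> nat \<times> nat"
  assumes "lbar1 \<ge> 0" and "lbar2 \<ge> 0"
    and "m1 > 0" and "m2 > 0" and "m1s \<ge> m1"
    and "r12 \<in> {0..1}" and "r21 \<in> {0..1}" and "r12 * r21 < 1"
    and "l1 = lbar1 + l2 * r21" and "l2 = lbar2 + l1 * r12"
    and "l1 > 0" and "l2 > 0"
    and "rho2 = l2 / m2"
    and "\<And>z. ctmc_from (P z) (modified_jackson_rate lbar1 lbar2 m1 m1s m2 r12 r21) z W"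
  shows "(l2 < m2 \<and> l1 < rho2 * m1 + (1 - rho2) * m1s \<longrightarrow> positive_recurrent P W) \<and>
         (l2 > m2 \<or> l1 > rho2 * m1 + (1 - rho2) * m1s \<longrightarrow> transient P W)"
proof -
  interpret modified_jackson lbar1 lbar2 m1 m2 m1s r12 r21 l1 l2
    by unfold_locales (use assms in auto)
  show ?thesis
    using positive_recurrent_if_stable[of P W] transient_if_overloaded[of P W] assms(13,14) by blast
qed

end
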